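(* There exists a constant $C$ such that for all $v_h\in S_h(t)$, $$\|v_h\|_{L^2(\Gamma(t))}\le C\,\|v_h\|_{H^1(\Omega)}.$$
   Context: **Interface.** $\Omega\subset\mathbb R^2$ is a fixed domain. For each $t\in[0,T]$, $\Gamma(t)$ is a sufficiently smooth simple closed (Jordan) curve not touching $\partial\Omega$, splitting $\Omega$ into $\Omega^-(t)$ and $\Omega^+(t)$. $\beta(X,t)=\beta^\pm$ for $X\in\Omega^\pm(t)$, with positive constants $\beta^\pm$. $[\cdot]_\gamma$ denotes the jump ("$-$" side minus "$+$" side) across a curve $\gamma$. **Mesh.** $\mathcal T_h$ is a shape regular, quasi-uniform triangulation of $\Omega$, independent of $\Gamma(t)$, with mesh size $h=\max_Th_T$ ($h_T$ the diameter of $T$, $h$ bounded above); $\mathcal N_h$ is the set of nodes. Elements meeting $\Gamma(t)$ are interface elements; $\Gamma(t)$ meets each of them in exactly two boundary points, on different edges. $\Gamma_h(t)$ is the polyline joining these intersection points; on an interface element the segment $\Gamma_h^T(t)=\Gamma_h(t)\cap T$ with normal $\bar{\mathbf n}$ divides $T$ into $T^\pm(t)$. **IFE space.** For an interface element, $S_{h,T}(t)=\{v: v|_{T^\pm}\in\mathbb P_1(T^\pm),\ [v]_{\Gamma_h^T(t)}=0,\ [\beta\nabla v\cdot\bar{\mathbf n}]_{\Gamma_h^T(t)}=0\}$ (with $\beta=\beta^\pm$ on $T^\pm$); otherwise $S_{h,T}(t)=\mathbb P_1(T)$. $S_h(t)=\{v\in L^2(\Omega): v|_T\in S_{h,T}(t)\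 \forall T\in\mathcal T_h,\ v\text{ continuous at each node of }\mathcal N_h,\ v|_{\partial\Omega}=0\}$. Functions in $S_h(t)$ may be discontinuous across edges cut by the interface, so $\|v_h\|_{H^1(\Omega)}$ is the broken norm $\big(\sum_{T\in\mathcal T_h}\|v_h\|_{H^1(T)}^2\big)^{1/2}$, and the trace on $\Gamma(t)$ is taken element by element. **Constants.** $C$ is independent of the mesh size and of the interface location relative to the mesh. *)

theory Defs
  imports "HOL-Analysis.Analysis"
begin

type_synonym point = "real ^ 2"

section \<open>The moving interface\<close>

text \<open>A curve \<open>\<Gamma>(t)\<close>, \<open>t \<in> [0, tmax]\<close>, is given by a parametrisation \<open>\<gamma> t\<close> on \<open>[0, 1]\<close>.
  The requirement is the least regularity that makes sense of a smooth evolution: each curve is a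
  regular closed \<open>C\<^sup>1\<close> curve, and the parametrisation and its tangent depend continuously on time.\<close>

definition smooth_moving_curve :: "real \<Rightarrow> (real \<Rightarrow> real \<Rightarrow> point) \<Rightarrow> bool" where
  "smooth_moving_curve tmax \<gamma> \<longleftrightarrow>
     (\<forall>t\<in>{0..tmax}. simple_path (\<gamma> t) \<and> pathfinish (\<gamma> t) = pathstart (\<gamma> t)) \<and>
     continuous_on ({0..tmax} \<times> {0..1}) (\<lambda>(t, s). \<gamma> t s) \<and>
     (\<exists>\<gamma>'. continuous_on ({0..tmax} \<times> {0..1}) (\<lambda>(t, s). \<gamma>' t s) \<and>
        (\<forall>t\<in>{0..tmax}. \<gamma>' t 0 = \<gamma>' t 1 \<and>
          (\<forall>s\<in>{0..1}. (\<gamma> t has_vector_derivative \<gamma>' t s) (at s within {0..1}) \<and> \<gamma>' t s \<noteq> 0)))"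

text \<open>Which of the two subdomains is called \<open>\<Omega>\<^sup>-\<close> is a matter of labelling, the coefficients
  \<open>\<beta>\<^sup>-\<close> and \<open>\<beta>\<^sup>+\<close> being arbitrary.\<close>

definition Omega_minus :: "point set \<Rightarrow> point set \<Rightarrow> point set" where
  "Omega_minus \<Omega> \<Gamma> = \<Omega> \<inter> inside \<Gamma>"

definition Omega_plus :: "point set \<Rightarrow> point set \<Rightarrow> point set" where
  "Omega_plus \<Omega> \<Gamma> = \<Omega> \<inter> outside \<Gamma>"

section \<open>The mesh\<close>

definition nodes :: "point set set \<Rightarrow> point set" where
  "nodes \<T> = {x. \<exists>K\<in>\<T>. x extreme_point_of K}"

definition mesh_size :: "point set set \<Rightarrow> real" where
  "mesh_size \<T> = Max (diameter ` \<T>)"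

definition inscribed_diameter :: "point set \<Rightarrow> real" where
  "inscribed_diameter K = (SUP r\<in>{r. \<exists>x. cball x r \<subseteq> K}. 2 * r)"

text \<open>Shape regularity and quasi-uniformity are properties of a family of meshes; the family is
  described by common constants \<open>\<sigma>\<close>, \<open>\<kappa>\<close> and a common upper bound \<open>h0\<close> of the mesh sizes.\<close>

definition admissible_mesh :: "point set \<Rightarrow> real \<Rightarrow> real \<Rightarrow> real \<Rightarrow> point set set \<Rightarrow> bool" where
  "admissible_mesh \<Omega> \<sigma> \<kappa> h0 \<T> \<longleftrightarrow>
     triangulation \<T> \<and> (\<forall>K\<in>\<T>. 2 simplex K) \<and> \<Union>\<T> = closure \<Omega> \<and>
     (\<forall>K\<in>\<T>. diameter K \<le> \<sigma> * inscribed_diameter K) \<and>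
     (\<forall>K\<in>\<T>. mesh_size \<T> \<le> \<kappa> * diameter K) \<and>
     mesh_size \<T> \<le> h0"

text \<open>An element is cut by the interface if its interior meets \<open>\<Gamma>\<close>; a curve passing through a node
  does not turn the elements that it only touches there into interface elements.\<close>

definition interface_element :: "point set \<Rightarrow> point set \<Rightarrow> bool" where
  "interface_element \<Gamma> K \<longleftrightarrow> \<Gamma> \<inter> interior K \<noteq> {}"

definition mesh_fits_interface :: "point set \<Rightarrow> point set set \<Rightarrow> bool" where
  "mesh_fits_interface \<Gamma> \<T> \<longleftrightarrow>
     (\<forall>K\<in>\<T>. interface_element \<Gamma> K \<longrightarrow>
       (\<exists>D E e f. D \<noteq> E \<and> \<Gamma> \<inter> frontier K = {D, E} \<and>
          e edge_of K \<and> f edge_of K \<and> e \<noteq> f \<and> D \<in> e \<and> E \<in> f))"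

text \<open>The part \<open>\<Gamma>\<^sub>h \<inter> K\<close> of the polyline \<open>\<Gamma>\<^sub>h\<close>: the segment joining the two points of
  \<open>\<Gamma> \<inter> \<partial>K\<close>.\<close>

definition interface_segment :: "point set \<Rightarrow> point set \<Rightarrow> point set" where
  "interface_segment \<Gamma> K = convex hull (\<Gamma> \<inter> frontier K)"

text \<open>The unit normal of the segment that points from the side of \<open>\<Omega>\<^sup>-\<close> to the side of \<open>\<Omega>\<^sup>+\<close>. The
  sides are recognised by the vertices of \<open>K\<close>; closures are needed because a vertex may lie
  on \<open>\<partial>\<Omega>\<close>.\<close>

definition interface_normal :: "point set \<Rightarrow> point set \<Rightarrow> point set \<Rightarrow> point \<Rightarrow> bool" where
  "interface_normal \<Omega> \<Gamma> K n \<longleftrightarrow>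
     norm n = 1 \<and>
     (\<forall>y\<in>interface_segment \<Gamma> K. \<forall>z\<in>interface_segment \<Gamma> K. (y - z) \<bullet> n = 0) \<and>
     (\<forall>y\<in>interface_segment \<Gamma> K. \<forall>x. x extreme_point_of K \<longrightarrow>
        ((x - y) \<bullet> n < 0 \<longrightarrow> x \<in> closure (Omega_minus \<Omega> \<Gamma>)) \<and>
        ((x - y) \<bullet> n > 0 \<longrightarrow> x \<in> closure (Omega_plus \<Omega> \<Gamma>)))"

text \<open>The pieces \<open>K\<^sup>-\<close> and \<open>K\<^sup>+\<close>, both taken closed.\<close>

definition minus_part :: "point set \<Rightarrow> point set \<Rightarrow> point \<Rightarrow> point set" where
  "minus_part \<Gamma> K n = {x \<in> K. \<forall>y\<in>interface_segment \<Gamma> K. (x - y) \<bullet> n \<le> 0}"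

definition plus_part :: "point set \<Rightarrow> point set \<Rightarrow> point \<Rightarrow> point set" where
  "plus_part \<Gamma> K n = {x \<in> K. \<forall>y\<in>interface_segment \<Gamma> K. (x - y) \<bullet> n \<ge> 0}"

section \<open>The immersed finite element space\<close>

text \<open>Functions are only relevant on the element \<open>K\<close>. A polynomial of degree at most one is written
  \<open>a + g \<bullet> x\<close>, so that \<open>g\<close> is its gradient.\<close>

definition local_ife_space ::
  "real \<Rightarrow> real \<Rightarrow> point set \<Rightarrow> point set \<Rightarrow> point set \<Rightarrow> (point \<Rightarrow> real) set" where
  "local_ife_space \<beta>m \<beta>p \<Omega> \<Gamma> K =
     (if interface_element \<Gamma> K then
        {v. \<exists>n am gm ap gp. interface_normal \<Omega> \<Gamma> K n \<and>
              (\<forall>x\<in>minus_part \<Gamma> K n. v x = am + gm \<bullet> x) \<and>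
              (\<forall>x\<in>plus_part \<Gamma> K n. v x = ap + gp \<bullet> x) \<and>
              (\<forall>x\<in>interface_segment \<Gamma> K. (am + gm \<bullet> x) - (ap + gp \<bullet> x) = 0) \<and>
              \<beta>m * (gm \<bullet> n) - \<beta>p * (gp \<bullet> n) = 0}
      else {v. \<exists>a g. \<forall>x\<in>K. v x = a + g \<bullet> x})"

text \<open>A function in \<open>L\<^sup>2(\<Omega>)\<close> that may jump across edges is represented by the family of its
  restrictions to the closed elements: \<open>v K\<close> is the restriction to \<open>K\<close>. In this way the one-sided
  values on edges, at nodes and on \<open>\<partial>\<Omega>\<close> are available.\<close>

type_synonym broken_fun = "point set \<Rightarrow> point \<Rightarrow> real"

definition ife_space ::
  "real \<Rightarrow> real \<Rightarrow> point set \<Rightarrow> point set \<Rightarrow> point set set \<Rightarrow> broken_fun set" where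
  "ife_space \<beta>m \<beta>p \<Omega> \<Gamma> \<T> =
     {v. (\<forall>K\<in>\<T>. v K \<in> local_ife_space \<beta>m \<beta>p \<Omega> \<Gamma> K) \<and>
         (\<forall>x\<in>nodes \<T>. \<forall>K\<in>\<T>. \<forall>L\<in>\<T>. x \<in> K \<and> x \<in> L \<longrightarrow> v K x = v L x) \<and>
         (\<forall>K\<in>\<T>. \<forall>x\<in>K \<inter> frontier \<Omega>. v K x = 0)}"

section \<open>Norms\<close>

definition grad :: "(point \<Rightarrow> real) \<Rightarrow> point \<Rightarrow> point" where
  "grad f x = (\<Sum>b\<in>Basis. frechet_derivative f (at x) b *\<^sub>R b)"

text \<open>Local finite element functions are continuous and piecewise affine on \<open>K\<close>, hence Lipschitz, so
  their weak gradient is the classical one, which exists off a null set. The complete measure makes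
  the values of \<open>grad\<close> on that null set irrelevant.\<close>

definition H1_norm :: "point set \<Rightarrow> (point \<Rightarrow> real) \<Rightarrow> real" where
  "H1_norm K f =
     sqrt ((LINT x:K|lebesgue. (f x)\<^sup>2) + (LINT x:K|lebesgue. (norm (grad f x))\<^sup>2))"

definition broken_H1_norm :: "point set set \<Rightarrow> broken_fun \<Rightarrow> real" where
  "broken_H1_norm \<T> v = sqrt (\<Sum>K\<in>\<T>. (H1_norm K (v K))\<^sup>2)"

text \<open>For a mesh that fits the interface, the choice of the element is immaterial for the norm below:
  apart from finitely many points, \<open>\<Gamma>\<close> meets an edge only if no adjacent element is an interface
  element, and then the values from both sides of the edge agree.\<close>

definition broken_trace :: "point set set \<Rightarrow> broken_fun \<Rightarrow> point \<Rightarrow> real" where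
  "broken_trace \<T> v x = v (SOME K. K \<in> \<T> \<and> x \<in> K) x"

definition L2_curve_norm :: "(real \<Rightarrow> point) \<Rightarrow> (point \<Rightarrow> real) \<Rightarrow> real" where
  "L2_curve_norm c f =
     sqrt (LINT s:{0..1}|lebesgue.
             (f (c s))\<^sup>2 * norm (vector_derivative c (at s within {0..1})))"

end

theory Submission
  imports Defs
begin

text \<open>On one element an IFE function is Lipschitz, and its two gradients have comparable length by the
  interface conditions; hence its oscillation is bounded by its \<open>H\<^sup>1\<close> norm and its maximum by
  \<open>h\<^sup>-\<^sup>1\<close> times that norm, wherever the interface cuts the element. No control of the jumps across
  edges is needed: two elements with a common point have a common node, and there the function is
  single-valued. So along a segment of fixed length \<open>\<delta>\<close> that starts at a point \<open>p\<close> of the curve, the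
  values differ by at most the sum of the oscillations on the elements that the segment meets. There
  are about \<open>\<delta> / h\<close> of them, and averaging over them bounds \<open>v(p)\<^sup>2\<close> by \<open>C / h\<close> times the sum of
  their squared \<open>H\<^sup>1\<close> norms. If the segments point in a coordinate direction transversal to the
  curve, each element is met only for a set of parameters of length \<open>O(h)\<close>, and integrating along
  the curve gives the estimate. Finitely many pieces of the curve, uniformly in time, suffice to
  have such directions.\<close>

section \<open>Estimates on one element\<close>

text \<open>What is kept of an IFE function: a line, an affine formula on each closed side of it,
  and comparable gradients. Both formulas apply on the line, which encodes continuity across it. The
  line may miss \<open>K\<close>, and either piece may be arbitrarily small.\<close>

definition piecewise_affine_on :: "real \<Rightarrow> point set \<Rightarrow> (point \<Rightarrow> real) \<Rightarrow> bool" where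
  "piecewise_affine_on R K v \<longleftrightarrow>
     (\<exists>n b am gm ap gp. n \<noteq> 0 \<and>
        (\<forall>x\<in>K. n \<bullet> x \<le> b \<longrightarrow> v x = am + gm \<bullet> x) \<and>
        (\<forall>x\<in>K. b \<le> n \<bullet> x \<longrightarrow> v x = ap + gp \<bullet> x) \<and>
        norm gm \<le> R * norm gp \<and> norm gp \<le> R * norm gm)"

text \<open>For nonzero \<open>w\<close>, its normalisation and \<open>n\<close> form an orthonormal
  basis of the plane, so this is Pythagoras for \<open>g\<close>, multiplied by
  \<open>(norm w)\<^sup>2\<close> to avoid a division.\<close>

lemma norm_decomposition_plane:
  fixes g w n :: point
  assumes "norm n = 1" "w \<bullet> n = 0"
  shows "(norm g)\<^sup>2 * (norm w)\<^sup>2 = (g \<bullet> w)\<^sup>2 + (norm w)\<^sup>2 * (g \<bullet> n)\<^sup>2"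
proof -
  \<comment> \<open>\<open>k\<close> is the coordinate of \<open>w\<close> along \<open>n\<close>
    turned by a right angle; writing \<open>w\<close> in this form leaves a polynomial identity
    modulo \<open>norm n = 1\<close>.\<close>
  define k where "k = w$2 * n$1 - w$1 * n$2"
  have n1: "n$1 * n$1 + n$2 * n$2 = 1"
    using assms(1) by (simp add: norm_eq_1 inner_vec_def sum_2)
  have wn: "w$1 * n$1 + w$2 * n$2 = 0"
    using assms(2) by (simp add: inner_vec_def sum_2)
  have w1: "w$1 = - k * n$2" unfolding k_def using n1 wn by algebra
  have w2: "w$2 = k * n$1" unfolding k_def using n1 wn by algebra
  have "(g$1 * g$1 + g$2 * g$2) * ((- k * n$2) * (- k * n$2) + (k * n$1) * (k * n$1)) =
     (g$1 * (- k * n$2) + g$2 * (k * n$1))\<^sup>2 +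
     ((- k * n$2) * (- k * n$2) + (k * n$1) * (k * n$1)) * (g$1 * n$1 + g$2 * n$2)\<^sup>2"
    using n1 by algebra
  then show ?thesis
    by (simp add: power2_norm_eq_inner inner_vec_def sum_2 w1 w2)
qed

text \<open>Here \<open>w\<close> is tangent to the interface segment. Continuity makes the
  tangential components of the two gradients equal, and the flux condition compares the normal ones,
  so the ratio of the norms does not depend on where the cut lies.\<close>

lemma norm_le_of_interface_conditions:
  fixes gm gp w n :: point
  assumes "norm n = 1" "w \<bullet> n = 0" "w \<noteq> 0" "gm \<bullet> w = gp \<bullet> w"
    and "\<bar>gm \<bullet> n\<bar> \<le> R * \<bar>gp \<bullet> n\<bar>" "1 \<le> R"
  shows "norm gm \<le> R * norm gp"
proof -
  have "(gm \<bullet> n)\<^sup>2 \<le> (R * \<bar>gp \<bullet> n\<bar>)\<^sup>2"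
    using assms(5) by (metis abs_ge_zero power2_abs power_mono)
  then have "(norm w)\<^sup>2 * (gm \<bullet> n)\<^sup>2 \<le> (norm w)\<^sup>2 * (R\<^sup>2 * (gp \<bullet> n)\<^sup>2)"
    by (intro mult_left_mono) (simp_all add: power_mult_distrib)
  moreover have "1 * (gp \<bullet> w)\<^sup>2 \<le> R\<^sup>2 * (gp \<bullet> w)\<^sup>2"
    using assms(6) by (intro mult_right_mono) (simp_all add: one_le_power)
  ultimately have "(norm gm)\<^sup>2 * (norm w)\<^sup>2 \<le> R\<^sup>2 * ((norm gp)\<^sup>2 * (norm w)\<^sup>2)"
    unfolding norm_decomposition_plane[OF assms(1,2)] assms(4) by (simp add: algebra_simps)
  then have "(norm gm)\<^sup>2 * (norm w)\<^sup>2 \<le> (R * norm gp)\<^sup>2 * (norm w)\<^sup>2"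
    by (simp add: power_mult_distrib mult.assoc)
  then have "(norm gm)\<^sup>2 \<le> (R * norm gp)\<^sup>2"
    using assms(3) by simp
  then show ?thesis
    using assms(6) by (auto dest: power2_le_imp_le)
qed

lemma local_ife_space_piecewise_affine:
  assumes v: "v \<in> local_ife_space \<beta>m \<beta>p \<Omega> \<Gamma> K" and "0 < \<beta>m" "0 < \<beta>p"
    and fit: "interface_element \<Gamma> K \<Longrightarrow> \<exists>D E. D \<noteq> E \<and> \<Gamma> \<inter> frontier K = {D, E}"
  shows "piecewise_affine_on (1 + \<beta>m / \<beta>p + \<beta>p / \<beta>m) K v"
proof (cases "interface_element \<Gamma> K")
  case False
  then obtain a g where ag: "\<forall>x\<in>K. v x = a + g \<bullet> x"
    using v by (auto simp: local_ife_space_def)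
  \<comment> \<open>On an uncut element any line serves, with the same affine formula on both
    sides.\<close>
  have "1 * norm g \<le> (1 + \<beta>m / \<beta>p + \<beta>p / \<beta>m) * norm g"
    using assms(2,3) by (intro mult_right_mono) simp_all
  moreover have "axis 1 1 \<noteq> (0::point)" by (simp add: axis_eq_0_iff)
  ultimately show ?thesis
    unfolding piecewise_affine_on_def using ag by (metis mult_1)
next
  case True
  then obtain D E where DE: "D \<noteq> E" "\<Gamma> \<inter> frontier K = {D, E}" using fit by blast
  obtain n am gm ap gp where n: "interface_normal \<Omega> \<Gamma> K n"
    and m: "\<forall>x\<in>minus_part \<Gamma> K n. v x = am + gm \<bullet> x"
    and p: "\<forall>x\<in>plus_part \<Gamma> K n. v x = ap + gp \<bullet> x"
    and c: "\<forall>x\<in>interface_segment \<Gamma> K. (am + gm \<bullet> x) - (ap + gp \<bullet> x) = 0"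
    and flux: "\<beta>m * (gm \<bullet> n) - \<beta>p * (gp \<bullet> n) = 0"
    using v True by (auto simp: local_ife_space_def)
  have seg: "D \<in> interface_segment \<Gamma> K" "E \<in> interface_segment \<Gamma> K"
    unfolding interface_segment_def DE by (simp_all add: hull_inc)
  have nn: "norm n = 1" using n by (simp add: interface_normal_def)
  have nD: "y \<bullet> n = D \<bullet> n" if "y \<in> interface_segment \<Gamma> K" for y
  proof -
    have "(y - D) \<bullet> n = 0" using n seg that unfolding interface_normal_def by blast
    then show ?thesis by (simp add: inner_diff_left)
  qed
  \<comment> \<open>The distinct points \<open>D\<close> and \<open>E\<close> give a nonzero
    tangent, and continuity at both gives equal derivatives along it. \<open>?R\<close> dominates 1
    and both coefficient ratios, so one factor serves both comparisons.\<close>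
  let ?w = "D - E" and ?R = "1 + \<beta>m / \<beta>p + \<beta>p / \<beta>m"
  have wn: "?w \<bullet> n = 0" using nD[OF seg(2)] by (simp add: inner_diff_left)
  have gw: "gm \<bullet> ?w = gp \<bullet> ?w"
    using c[rule_format, OF seg(1)] c[rule_format, OF seg(2)] by (simp add: inner_diff_right)
  have R: "1 \<le> ?R" "\<beta>p / \<beta>m \<le> ?R" "\<beta>m / \<beta>p \<le> ?R" using assms(2,3) by simp_all
  have "gm \<bullet> n = \<beta>p / \<beta>m * (gp \<bullet> n)" "gp \<bullet> n = \<beta>m / \<beta>p * (gm \<bullet> n)"
    using flux assms(2,3) by (simp_all add: field_simps)
  then have "\<bar>gm \<bullet> n\<bar> = \<beta>p / \<beta>m * \<bar>gp \<bullet> n\<bar>" "\<bar>gp \<bullet> n\<bar> = \<beta>m / \<beta>p * \<bar>gm \<bullet> n\<bar>"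
    using assms(2,3) by (simp_all add: abs_mult)
  then have ab: "\<bar>gm \<bullet> n\<bar> \<le> ?R * \<bar>gp \<bullet> n\<bar>" "\<bar>gp \<bullet> n\<bar> \<le> ?R * \<bar>gm \<bullet> n\<bar>"
    using R by (metis abs_ge_zero mult_right_mono)+
  have "norm gm \<le> ?R * norm gp"
    using norm_le_of_interface_conditions[OF nn wn _ gw ab(1) R(1)] DE(1) by simp
  moreover have "norm gp \<le> ?R * norm gm"
    using norm_le_of_interface_conditions[OF nn wn _ gw[symmetric] ab(2) R(1)] DE(1) by simp
  moreover have "n \<noteq> 0" using nn by auto
  moreover have "v x = am + gm \<bullet> x" if "x \<in> K" "n \<bullet> x \<le> D \<bullet> n" for x
  proof -
    have "x \<in> minus_part \<Gamma> K n"
      using that nD by (auto simp: minus_part_def inner_diff_left inner_commute[of x n])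
    then show ?thesis using m by blast
  qed
  moreover have "v x = ap + gp \<bullet> x" if "x \<in> K" "D \<bullet> n \<le> n \<bullet> x" for x
  proof -
    have "x \<in> plus_part \<Gamma> K n"
      using that nD by (auto simp: plus_part_def inner_diff_left inner_commute[of x n])
    then show ?thesis using p by blast
  qed
  ultimately show ?thesis unfolding piecewise_affine_on_def by blast
qed

section \<open>Gradient, oscillation and size on one element\<close>

lemma grad_affine:
  assumes "open U" "x \<in> U" and v: "\<And>y. y \<in> U \<Longrightarrow> v y = a + g \<bullet> y"
  shows "grad v x = g"
proof -
  have "((\<lambda>y. a + g \<bullet> y) has_derivative (\<lambda>h. g \<bullet> h)) (at x)"
    by (auto intro!: derivative_eq_intros)
  then have "(v has_derivative (\<lambda>h. g \<bullet> h)) (at x)"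
    by (rule has_derivative_transform_within_open[OF _ assms(1,2)]) (simp add: v)
  then have "frechet_derivative v (at x) = (\<lambda>h. g \<bullet> h)"
    by (rule frechet_derivative_at[symmetric])
  then show ?thesis by (simp add: grad_def euclidean_representation)
qed

text \<open>Only points on opposite sides need an argument: the segment between them crosses the
  line at some \<open>z\<close>, both formulas are valid there, and the distances to
  \<open>z\<close> add up to \<open>dist x y\<close>.\<close>

lemma piecewise_affine_lipschitz:
  fixes K :: "'a::euclidean_space set"
  assumes "convex K"
    and vm: "\<And>x. x \<in> K \<Longrightarrow> n \<bullet> x \<le> b \<Longrightarrow> v x = am + gm \<bullet> x"
    and vp: "\<And>x. x \<in> K \<Longrightarrow> b \<le> n \<bullet> x \<Longrightarrow> v x = ap + gp \<bullet> x"
    and G: "norm gm \<le> G" "norm gp \<le> G"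
    and xy: "x \<in> K" "y \<in> K"
  shows "\<bar>v x - v y\<bar> \<le> G * dist x y"
proof -
  have aff: "norm g \<le> G \<Longrightarrow> \<bar>(a + g \<bullet> x) - (a + g \<bullet> y)\<bar> \<le> G * dist x y"
    for a and g x y :: 'a
  proof -
    assume that: "norm g \<le> G"
    have "\<bar>g \<bullet> (x - y)\<bar> \<le> norm g * norm (x - y)" by (rule Cauchy_Schwarz_ineq2)
    also have "\<dots> \<le> G * norm (x - y)" using that by (intro mult_right_mono) auto
    finally show ?thesis by (simp add: dist_norm inner_diff_right)
  qed
  have cross: "\<bar>v x - v y\<bar> \<le> G * dist x y"
    if x: "x \<in> K" "n \<bullet> x \<le> b" and y: "y \<in> K" "b \<le> n \<bullet> y" for x y
  proof -
    obtain z where z: "z \<in> closed_segment x y" "n \<bullet> z = b"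
      using connected_ivt_hyperplane[of "closed_segment x y" x y n b] x(2) y(2) by auto
    have zK: "z \<in> K" using closed_segment_subset[OF x(1) y(1) assms(1)] z(1) by blast
    have "\<bar>v x - v z\<bar> \<le> G * dist x z"
      using aff[OF G(1)] vm[OF x] vm[OF zK] z(2) by simp
    moreover have "\<bar>v z - v y\<bar> \<le> G * dist z y"
      using aff[OF G(2)] vp[OF y] vp[OF zK] z(2) by simp
    moreover have "dist x y = dist x z + dist z y"
      using z(1) between[of x y z] by (simp add: between_mem_segment)
    ultimately show ?thesis by (simp add: distrib_left)
  qed
  show ?thesis
  proof (cases "n \<bullet> x \<le> b"; cases "n \<bullet> y \<le> b")
    assume "n \<bullet> x \<le> b" "n \<bullet> y \<le> b"
    then show ?thesis using aff[OF G(1)] vm xy by simp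
  next
    assume "n \<bullet> x \<le> b" "\<not> n \<bullet> y \<le> b"
    then show ?thesis using cross[of x y] xy by simp
  next
    assume "\<not> n \<bullet> x \<le> b" "n \<bullet> y \<le> b"
    then show ?thesis using cross[of y x] xy by (simp add: dist_commute abs_minus_commute)
  next
    assume "\<not> n \<bullet> x \<le> b" "\<not> n \<bullet> y \<le> b"
    then show ?thesis using aff[OF G(2)] vp xy by simp
  qed
qed

text \<open>With \<open>G\<close> the larger gradient length, comparability makes the smaller one at
  least \<open>G / R\<close>. The gradient integral therefore controls \<open>G\<close> over the
  full area of \<open>K\<close>, even if the cut leaves a tiny piece; this is the source of
  independence from the interface location.\<close>

lemma piecewise_affine_gradient_bound:
  assumes pa: "piecewise_affine_on R K v" and K: "compact K" "convex K" and R: "1 \<le> R"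
  obtains G where "0 \<le> G" "\<And>x y. x \<in> K \<Longrightarrow> y \<in> K \<Longrightarrow> \<bar>v x - v y\<bar> \<le> G * dist x y"
    "G\<^sup>2 * measure lebesgue K \<le> R\<^sup>2 * (LINT x:K|lebesgue. (norm (grad v x))\<^sup>2)"
proof -
  obtain n b am gm ap gp where n: "n \<noteq> 0"
    and vm: "\<And>x. x \<in> K \<Longrightarrow> n \<bullet> x \<le> b \<Longrightarrow> v x = am + gm \<bullet> x"
    and vp: "\<And>x. x \<in> K \<Longrightarrow> b \<le> n \<bullet> x \<Longrightarrow> v x = ap + gp \<bullet> x"
    and g: "norm gm \<le> R * norm gp" "norm gp \<le> R * norm gm"
    using pa unfolding piecewise_affine_on_def by metis
  define G where "G = max (norm gm) (norm gp)"
  have "norm g \<le> R * norm g" for g :: point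
    using mult_right_mono[OF R norm_ge_zero[of g]] by simp
  then have Gle: "G \<le> R * norm gm" "G \<le> R * norm gp" using g by (auto simp: G_def)
  have G0: "0 \<le> G" by (simp add: G_def le_max_iff_disj)
  define A where "A = interior K \<inter> {x. n \<bullet> x < b}"
  define B where "B = interior K \<inter> {x. n \<bullet> x > b}"
  \<comment> \<open>At points of \<open>K\<close> off this null set, \<open>v\<close> agrees nearby
    with one affine function, so \<open>grad v\<close> is \<open>gm\<close> or
    \<open>gp\<close>.\<close>
  define N where "N = frontier K \<union> {x. n \<bullet> x = b}"
  have AB: "open A" "open B" "bounded A" "bounded B"
    unfolding A_def B_def using K(1)
    by (simp_all add: open_Int open_halfspace_lt open_halfspace_gt bounded_Int
        bounded_interior compact_imp_bounded)
  have gA: "grad v x = gm" if "x \<in> A" for x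
    using that interior_subset[of K]
    by (intro grad_affine[OF AB(1), where a = am] vm) (auto simp: A_def)
  have gB: "grad v x = gp" if "x \<in> B" for x
    using that interior_subset[of K]
    by (intro grad_affine[OF AB(2), where a = ap] vp) (auto simp: B_def)
  have N: "negligible N" unfolding N_def
    using negligible_convex_frontier[OF K(2)] negligible_hyperplane[of n b] n by simp
  have KAB: "K - N \<subseteq> A \<union> B"
    using closure_subset[of K] by (auto simp: A_def B_def N_def frontier_def)
  have ABK: "A \<union> B \<subseteq> K" using interior_subset[of K] by (auto simp: A_def B_def)
  let ?f = "\<lambda>x. (norm (grad v x))\<^sup>2"
  \<comment> \<open>Integrability has to be established, as a non-integrable function has integral 0
    by convention. It is clear on the open pieces, where the gradient is constant, and passes to
    \<open>K\<close> up to a null set.\<close>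
  have "?f absolutely_integrable_on A"
    using absolutely_integrable_on_const[OF lmeasurable_open[OF AB(3,1)], of "(norm gm)\<^sup>2"]
    by (rule absolutely_integrable_spike[OF _ negligible_empty]) (simp add: gA)
  moreover have "?f absolutely_integrable_on B"
    using absolutely_integrable_on_const[OF lmeasurable_open[OF AB(4,2)], of "(norm gp)\<^sup>2"]
    by (rule absolutely_integrable_spike[OF _ negligible_empty]) (simp add: gB)
  ultimately have "?f absolutely_integrable_on A \<union> B" by (rule absolutely_integrable_Un)
  moreover have "(?f absolutely_integrable_on A \<union> B) = (?f absolutely_integrable_on K)"
    using KAB ABK by (intro absolutely_integrable_spike_set_eq negligible_subset[OF N]) auto
  ultimately have fint: "set_integrable lebesgue K ?f" by simp
  have Klm: "K \<in> lmeasurable" using K(1) by (rule lmeasurable_compact)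
  have "G\<^sup>2 \<le> R\<^sup>2 * ?f x" if "x \<in> K" "x \<notin> N" for x
  proof -
    have "G \<le> R * norm (grad v x)" using that KAB gA gB Gle by force
    then show ?thesis using power_mono[OF _ G0] by (metis power_mult_distrib)
  qed
  then have ae: "AE x\<in>K in lebesgue. G\<^sup>2 \<le> R\<^sup>2 * ?f x"
    using N by (intro AE_I'[of N]) (auto simp: negligible_iff_null_sets)
  have "(LINT x:K|lebesgue. G\<^sup>2) \<le> (LINT x:K|lebesgue. R\<^sup>2 * ?f x)"
    using absolutely_integrable_on_const[OF Klm, of "G\<^sup>2"] fint ae
    by (intro set_integral_mono_AE) auto
  then have "G\<^sup>2 * measure lebesgue K \<le> R\<^sup>2 * (LINT x:K|lebesgue. ?f x)"
    using Klm by (subst (asm) set_integral_const) (auto simp: fmeasurable_def mult.commute)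
  moreover have "\<bar>v x - v y\<bar> \<le> G * dist x y" if "x \<in> K" "y \<in> K" for x y
    using piecewise_affine_lipschitz[OF K(2) vm vp _ _ that] by (simp add: G_def)
  ultimately show thesis using that G0 by blast
qed

text \<open>In the plane the area, of order h^2, exactly compensates the factor \<open>h\<close>
  between gradient and oscillation, so the first bound carries no power of \<open>h\<close>. For the
  second, \<open>v x\<close> is compared with \<open>v y\<close> and integrated over
  \<open>y\<close> in \<open>K\<close>, which costs a division by the area.\<close>

lemma piecewise_affine_element_bounds:
  assumes pa: "piecewise_affine_on R K v" and K: "compact K" "convex K" "diameter K \<le> h"
    and R: "1 \<le> R" and m: "c * h\<^sup>2 \<le> measure lebesgue K" "0 < c" "0 < h" "h \<le> h0"
  shows "\<And>x y. x \<in> K \<Longrightarrow> y \<in> K \<Longrightarrow> \<bar>v x - v y\<bar> \<le> R / sqrt c * H1_norm K v"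
    and "\<And>x. x \<in> K \<Longrightarrow> (v x)\<^sup>2 \<le> 2 * (1 + R\<^sup>2 * h0\<^sup>2) / (c * h\<^sup>2) * (H1_norm K v)\<^sup>2"
proof -
  obtain G where G: "0 \<le> G" "\<And>x y. x \<in> K \<Longrightarrow> y \<in> K \<Longrightarrow> \<bar>v x - v y\<bar> \<le> G * dist x y"
    "G\<^sup>2 * measure lebesgue K \<le> R\<^sup>2 * (LINT x:K|lebesgue. (norm (grad v x))\<^sup>2)"
    using piecewise_affine_gradient_bound[OF pa K(1,2) R] by blast
  let ?H = "H1_norm K v" and ?m = "measure lebesgue K"
  let ?g = "LINT x:K|lebesgue. (norm (grad v x))\<^sup>2" and ?v = "LINT x:K|lebesgue. (v x)\<^sup>2"
  have nn: "0 \<le> ?g" "0 \<le> ?v" by (simp_all add: set_lebesgue_integral_def Bochner_Integration.integral_nonneg)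
  have H: "?H\<^sup>2 = ?v + ?g" "0 \<le> ?H" using nn by (simp_all add: H1_norm_def)
  have ch: "0 < c * h\<^sup>2" using m by simp
  have "G\<^sup>2 * (c * h\<^sup>2) \<le> G\<^sup>2 * ?m" using m(1) by (intro mult_left_mono) auto
  also have "\<dots> \<le> R\<^sup>2 * ?H\<^sup>2"
    using G(3) mult_left_mono[of ?g "?H\<^sup>2" "R\<^sup>2"] nn H by simp
  finally have "(G * h)\<^sup>2 * c \<le> R\<^sup>2 * ?H\<^sup>2" by (simp add: power_mult_distrib mult_ac)
  then have Gh: "(G * h)\<^sup>2 \<le> (R / sqrt c * ?H)\<^sup>2"
    using m(2) by (simp add: power_mult_distrib power_divide pos_le_divide_eq)
  have Gh': "G * h \<le> R / sqrt c * ?H"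
    by (rule power2_le_imp_le[OF Gh]) (use R m(2) H(2) in simp)
  have osc: "\<bar>v x - v y\<bar> \<le> G * h" if "x \<in> K" "y \<in> K" for x y
  proof -
    have "dist x y \<le> h"
      using diameter_bounded(1)[OF compact_imp_bounded[OF K(1)]] that K(3) by force
    then show ?thesis using G(2)[OF that] mult_left_mono[OF _ G(1)] by (meson order_trans)
  qed
  show "\<bar>v x - v y\<bar> \<le> R / sqrt c * ?H" if "x \<in> K" "y \<in> K" for x y
    using osc[OF that] Gh' by simp
  show "(v x)\<^sup>2 \<le> 2 * (1 + R\<^sup>2 * h0\<^sup>2) / (c * h\<^sup>2) * ?H\<^sup>2" if x: "x \<in> K" for x
  proof -
    have "continuous_on K v"
      using G(1,2) by (intro lipschitz_on_continuous_on[of G] lipschitz_onI) (auto simp: dist_real_def)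
    then have "integrable lborel (\<lambda>y. indicator K y *\<^sub>R (v y)\<^sup>2)"
      by (intro borel_integrable_compact K continuous_intros)
    then have vint: "set_integrable lebesgue K (\<lambda>y. (v y)\<^sup>2)"
      unfolding set_integrable_def by (subst integrable_completion) auto
    have Klm: "K \<in> lmeasurable" using K(1) by (rule lmeasurable_compact)
    have cint: "set_integrable lebesgue K (\<lambda>y. d)" for d :: real
      using Klm by (rule absolutely_integrable_on_const)
    have "(v x)\<^sup>2 \<le> 2 * (v y)\<^sup>2 + 2 * (G * h)\<^sup>2" if "y \<in> K" for y
    proof -
      have "(v x - v y)\<^sup>2 \<le> (G * h)\<^sup>2"
        using power_mono[OF osc[OF x that], of 2] by simp
      moreover have "(v x)\<^sup>2 \<le> 2 * (v y)\<^sup>2 + 2 * (v x - v y)\<^sup>2"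
        using zero_le_power2[of "v x - 2 * v y"] by (simp add: power2_eq_square algebra_simps)
      ultimately show ?thesis by simp
    qed
    then have "(LINT y:K|lebesgue. (v x)\<^sup>2) \<le> (LINT y:K|lebesgue. 2 * (v y)\<^sup>2 + 2 * (G * h)\<^sup>2)"
      by (intro set_integral_mono cint set_integral_add set_integrable_mult_right vint) auto
    also have "\<dots> = 2 * ?v + ?m * (2 * (G * h)\<^sup>2)"
      using Klm by (subst set_integral_add) (auto intro!: cint vint simp: set_integral_const fmeasurable_def)
    finally have "(v x)\<^sup>2 * ?m \<le> 2 * ?v + ?m * (2 * (G * h)\<^sup>2)"
      using Klm by (subst (asm) set_integral_const) (auto simp: fmeasurable_def mult.commute)
    then have "((v x)\<^sup>2 - 2 * (G * h)\<^sup>2) * ?m \<le> 2 * ?H\<^sup>2"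
      using H nn by (simp add: algebra_simps)
    \<comment> \<open>The area may be lowered to \<open>c * h\<^sup>2\<close>: the product decreases
      if the left factor is nonnegative, and the claim is trivial otherwise.\<close>
    then have "((v x)\<^sup>2 - 2 * (G * h)\<^sup>2) * (c * h\<^sup>2) \<le> 2 * ?H\<^sup>2"
      using m(1) ch by (smt (verit) mult_left_mono mult_nonneg_nonneg mult_nonpos_nonneg zero_le_power2)
    then have "(v x)\<^sup>2 - 2 * (G * h)\<^sup>2 \<le> 2 * ?H\<^sup>2 / (c * h\<^sup>2)"
      using ch by (simp add: pos_le_divide_eq)
    \<comment> \<open>The bound \<open>h \<le> h0\<close> gives the oscillation term the same factor
      1/h^2 as the other term.\<close>
    moreover have "(G * h)\<^sup>2 \<le> R\<^sup>2 * h0\<^sup>2 * ?H\<^sup>2 / (c * h\<^sup>2)"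
    proof -
      have "(G * h)\<^sup>2 \<le> R\<^sup>2 * ?H\<^sup>2 / c"
        using Gh m(2) by (simp add: power_mult_distrib power_divide)
      also have "\<dots> = R\<^sup>2 * ?H\<^sup>2 * h\<^sup>2 / (c * h\<^sup>2)" using m(3) by simp
      also have "\<dots> \<le> R\<^sup>2 * ?H\<^sup>2 * h0\<^sup>2 / (c * h\<^sup>2)"
        using m ch by (intro divide_right_mono mult_left_mono power_mono) auto
      finally show ?thesis by (simp add: mult_ac)
    qed
    ultimately have "(v x)\<^sup>2 \<le> 2 * ?H\<^sup>2 / (c * h\<^sup>2) + 2 * (R\<^sup>2 * h0\<^sup>2 * ?H\<^sup>2 / (c * h\<^sup>2))" by linarith
    also have "\<dots> = 2 * (1 + R\<^sup>2 * h0\<^sup>2) / (c * h\<^sup>2) * ?H\<^sup>2" by (simp add: add_divide_distrib algebra_simps)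
    finally show ?thesis .
  qed
qed

section \<open>Elements along a segment\<close>

lemma square_subset_cball:
  fixes x :: point
  shows "cbox (x - vec (r / 2)) (x + vec (r / 2)) \<subseteq> cball x r"
proof
  fix y assume y: "y \<in> cbox (x - vec (r / 2)) (x + vec (r / 2))"
  then have "x $ i - r / 2 \<le> y $ i \<and> y $ i \<le> x $ i + r / 2" for i
    unfolding mem_box_cart by simp
  then have "\<bar>(y - x) $ i\<bar> \<le> r / 2" for i
    unfolding vector_minus_component abs_le_iff by (metis (no_types) add.commute diff_le_eq minus_diff_eq)
  then have "(\<Sum>i\<in>UNIV. \<bar>(y - x) $ i\<bar>) \<le> (\<Sum>i\<in>(UNIV::2 set). r / 2)"
    by (rule sum_mono)
  then have "norm (y - x) \<le> r"
    using norm_le_l1_cart[of "y - x"] by simp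
  then show "y \<in> cball x r" by (simp add: dist_norm norm_minus_commute)
qed

text \<open>The existence of an element of positive diameter forces \<open>\<sigma>\<close> and
  \<open>\<kappa>\<close> to be positive. For the area, shape regularity supplies an inscribed disc,
  quasi-uniformity bounds its radius below by a multiple of the mesh size, and a square with that
  side fits into the disc.\<close>

lemma admissible_mesh_element:
  assumes adm: "admissible_mesh \<Omega> \<sigma> \<kappa> h0 \<T>" and K: "K \<in> \<T>"
  shows "0 < \<sigma>" "0 < \<kappa>" "0 < mesh_size \<T>" "diameter K \<le> mesh_size \<T>"
    and "(1 / (4 * \<sigma> * \<kappa>))\<^sup>2 * (mesh_size \<T>)\<^sup>2 \<le> measure lebesgue K"
proof -
  have fin: "finite \<T>" and simp2: "2 simplex K"
    and sig: "diameter K \<le> \<sigma> * inscribed_diameter K" and kap: "mesh_size \<T> \<le> \<kappa> * diameter K"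
    using adm K by (auto simp: admissible_mesh_def triangulation_def)
  have cK: "compact K" using simp2 by (rule compact_simplex)
  have dim: "aff_dim K = 2" using aff_dim_simplex[OF simp2] .
  then have "K \<noteq> {}" by auto
  then obtain x where x: "x \<in> K" by blast
  have "K \<noteq> {x}" using dim by auto
  then obtain y where "y \<in> K" "y \<noteq> x" using x by blast
  then have diam: "0 < diameter K"
    using diameter_bounded(1)[OF compact_imp_bounded[OF cK]] x
    by (metis dual_order.strict_trans1 zero_less_dist_iff)
  show dH: "diameter K \<le> mesh_size \<T>"
    unfolding mesh_size_def using fin K by simp
  then show H: "0 < mesh_size \<T>" using diam by simp
  then have "0 < \<kappa> * diameter K" using kap by simp
  then show k0: "0 < \<kappa>" using diam by (simp add: zero_less_mult_iff)
  let ?R = "{r. \<exists>x. cball x r \<subseteq> K}"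
  \<comment> \<open>Negative radii belong to \<open>?R\<close> too, because their balls are empty;
    hence the case distinction.\<close>
  have ub: "2 * r \<le> diameter K" if "r \<in> ?R" for r
  proof (cases "0 \<le> r")
    case True
    obtain z where "cball z r \<subseteq> K" using \<open>r \<in> ?R\<close> by blast
    then have "diameter (cball z r) \<le> diameter K"
      using diameter_subset[OF _ compact_imp_bounded[OF cK]] by blast
    then show ?thesis using True by (simp add: diameter_cball split: if_splits)
  next
    case False
    then show ?thesis using diam by simp
  qed
  have bdd: "bdd_above ((\<lambda>r. 2 * r) ` ?R)" using ub by (auto intro!: bdd_aboveI2)
  have R0: "0 \<in> ?R" using x by auto
  then have "0 \<le> inscribed_diameter K"
    unfolding inscribed_diameter_def using cSUP_upper[OF R0 bdd] by simp
  moreover have "0 < \<sigma> * inscribed_diameter K" using sig diam by simp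
  ultimately show s0: "0 < \<sigma>" by (auto simp: zero_less_mult_iff)
  \<comment> \<open>Giving away a factor 2 puts this value strictly below the supremum, so some
    actual disc exceeds it. Together with passing from diameter to radius this yields the 4 in the
    constant.\<close>
  have "diameter K / (2 * \<sigma>) < inscribed_diameter K"
    using sig diam s0 by (simp add: field_simps)
  then obtain r where r: "r \<in> ?R" "diameter K / (2 * \<sigma>) < 2 * r"
    unfolding inscribed_diameter_def using less_cSUP_iff[OF _ bdd] R0 by blast
  then obtain z where z: "cball z r \<subseteq> K" by blast
  define \<rho> where "\<rho> = 1 / (4 * \<sigma> * \<kappa>) * mesh_size \<T>"
  have \<rho>0: "0 < \<rho>" using H s0 k0 by (simp add: \<rho>_def)
  have "diameter K \<le> 4 * \<sigma> * r" using r(2) s0 by (simp add: field_simps)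
  then have "mesh_size \<T> \<le> \<kappa> * (4 * \<sigma> * r)"
    using kap k0 by (meson mult_left_mono less_imp_le order_trans)
  then have "\<rho> \<le> r" using s0 k0 by (simp add: \<rho>_def field_simps)
  then have "cball z \<rho> \<subseteq> K" using z by (meson order_trans subset_cball)
  then have sub: "cbox (z - vec (\<rho> / 2)) (z + vec (\<rho> / 2)) \<subseteq> K"
    using square_subset_cball[of z \<rho>] by blast
  have "cbox (z - vec (\<rho> / 2)) (z + vec (\<rho> / 2)) \<noteq> {}"
    using \<rho>0 by (simp add: interval_ne_empty_cart)
  then have "\<rho>\<^sup>2 = measure lebesgue (cbox (z - vec (\<rho> / 2)) (z + vec (\<rho> / 2)))"
    by (simp add: content_cbox_cart power2_eq_square UNIV_2)
  also have "\<dots> \<le> measure lebesgue K"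
    using sub cK by (intro measure_mono_fmeasurable) (auto intro: lmeasurable_compact)
  finally show "(1 / (4 * \<sigma> * \<kappa>))\<^sup>2 * (mesh_size \<T>)\<^sup>2 \<le> measure lebesgue K"
    unfolding \<rho>_def power_mult_distrib .
qed

text \<open>The intersection is a nonempty compact convex face of \<open>K\<close>; it has an
  extreme point, and extreme points of a face are extreme in the whole element.\<close>

lemma triangulation_common_node:
  assumes tri: "triangulation \<T>" and KL: "K \<in> \<T>" "L \<in> \<T>" "K \<inter> L \<noteq> {}"
  shows "\<exists>z\<in>nodes \<T>. z \<in> K \<inter> L"
proof -
  have face: "K \<inter> L face_of K" and "\<exists>n. n simplex K" "\<exists>n. n simplex L"
    using tri KL by (auto simp: triangulation_def)
  then have "compact (K \<inter> L)" "convex (K \<inter> L)"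
    by (auto intro: compact_simplex convex_simplex compact_Int convex_Int)
  then obtain z where "z extreme_point_of (K \<inter> L)"
    using extreme_point_exists_convex KL(3) by blast
  then have "z extreme_point_of K" "z \<in> K \<inter> L"
    using extreme_point_of_face[OF face] by auto
  then show ?thesis using KL(1) by (auto simp: nodes_def)
qed

text \<open>The intersection cannot equal both elements, so it is a proper face of at least one and
  lies in the frontier of that convex set, which is null.\<close>

lemma triangulation_negligible_overlap:
  fixes \<T> :: "'a::euclidean_space set set"
  assumes tri: "triangulation \<T>" and KL: "K \<in> \<T>" "L \<in> \<T>" "K \<noteq> L"
  shows "negligible (K \<inter> L)"
proof -
  have faces: "K \<inter> L face_of K" "L \<inter> K face_of L"
    using tri KL by (auto simp: triangulation_def)
  have fr: "negligible (A \<inter> B)"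
    if AB: "A \<in> \<T>" "A \<inter> B face_of A" "A \<inter> B \<noteq> A" for A B
  proof -
    have "\<exists>n. n simplex A" using tri AB(1) by (auto simp: triangulation_def)
    then have "negligible (frontier A)"
      using convex_simplex by (auto intro: negligible_convex_frontier)
    moreover have "A \<inter> B \<subseteq> frontier A"
      using face_of_disjoint_interior[OF AB(2,3)] closure_subset[of A]
      by (auto simp: frontier_def)
    ultimately show ?thesis by (rule negligible_subset)
  qed
  show ?thesis
  proof (cases "K \<inter> L = K")
    case False
    then show ?thesis using fr KL faces by blast
  next
    case True
    then have "L \<inter> K \<noteq> L" using KL(3) by blast
    then have "negligible (L \<inter> K)" using fr KL faces by blast
    then show ?thesis by (simp add: Int_commute)
  qed
qed

text \<open>Otherwise the unions of the two subfamilies would be disjoint closed sets separating the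
  connected \<open>P\<close>. This supplies the next member when a subfamily is enlarged.\<close>

lemma connected_finite_closed_cover_touch:
  assumes "finite S" "connected P" "P \<subseteq> \<Union>S"
    and S: "\<And>K. K \<in> S \<Longrightarrow> closed K" "\<And>K. K \<in> S \<Longrightarrow> K \<inter> P \<noteq> {}"
    and R: "R \<subseteq> S" "R \<noteq> {}" "R \<noteq> S"
  shows "\<exists>K\<in>R. \<exists>L\<in>S - R. K \<inter> L \<noteq> {}"
proof (rule ccontr)
  assume no: "\<not> ?thesis"
  have "closed (\<Union>R)" "closed (\<Union>(S - R))"
    using assms(1) R(1) S(1) by (auto intro!: closed_Union intro: finite_subset)
  moreover have "P \<subseteq> \<Union>R \<union> \<Union>(S - R)" using assms(3) by blast
  moreover have "\<Union>R \<inter> \<Union>(S - R) \<inter> P = {}" using no by blast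
  moreover have "\<Union>R \<inter> P \<noteq> {}" "\<Union>(S - R) \<inter> P \<noteq> {}" using R S(2) by blast+
  ultimately show False using assms(2) unfolding connected_closed by blast
qed

text \<open>Values propagate along the cover: enlarging a subfamily by one touching member costs at most
  the oscillation on that member, and no member is used twice.\<close>

lemma connected_cover_oscillation:
  fixes f :: "'a::topological_space set \<Rightarrow> 'a \<Rightarrow> real"
  assumes S: "finite S" "connected P" "P \<subseteq> \<Union>S"
      "\<And>K. K \<in> S \<Longrightarrow> closed K" "\<And>K. K \<in> S \<Longrightarrow> K \<inter> P \<noteq> {}"
    and osc: "\<And>K x y. K \<in> S \<Longrightarrow> x \<in> K \<Longrightarrow> y \<in> K \<Longrightarrow> \<bar>f K x - f K y\<bar> \<le> B K"
    and node: "\<And>K L. K \<in> S \<Longrightarrow> L \<in> S \<Longrightarrow> K \<inter> L \<noteq> {} \<Longrightarrow> \<exists>z\<in>K \<inter> L. f K z = f L z"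
    and p: "K0 \<in> S" "p \<in> K0" and x: "L \<in> S" "x \<in> L"
  shows "\<bar>f L x - f K0 p\<bar> \<le> sum B S"
proof -
  have "\<exists>R\<subseteq>S. card R = Suc k \<and> K0 \<in> R \<and> (\<forall>L\<in>R. \<forall>x\<in>L. \<bar>f L x - f K0 p\<bar> \<le> sum B R)"
    if "Suc k \<le> card S" for k
    using that
  proof (induction k)
    case 0
    show ?case using osc p by (intro exI[of _ "{K0}"]) auto
  next
    case (Suc k)
    then obtain R where R: "R \<subseteq> S" "card R = Suc k" "K0 \<in> R"
      and bd: "\<And>L x. L \<in> R \<Longrightarrow> x \<in> L \<Longrightarrow> \<bar>f L x - f K0 p\<bar> \<le> sum B R" by auto
    have "R \<noteq> S" using R(2) Suc.prems by auto
    then obtain K L where KL: "K \<in> R" "L \<in> S - R" "K \<inter> L \<noteq> {}"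
      using connected_finite_closed_cover_touch[OF S R(1)] R(3) by blast
    then obtain z where z: "z \<in> K" "z \<in> L" "f K z = f L z"
      using node[of K L] R(1) by blast
    have finR: "finite R" using R(1) S(1) by (rule finite_subset)
    \<comment> \<open>Taking both points equal shows that the new bound is nonnegative, so the
      estimates on the old members survive the enlargement.\<close>
    have B0: "0 \<le> B L" using osc[of L z z] KL(2) z(2) by simp
    have "\<bar>f L x - f K0 p\<bar> \<le> sum B (insert L R)" if "x \<in> L" for x
      using osc[of L x z] bd[OF KL(1) z(1)] z KL(2) that finR by simp
    moreover have "\<bar>f M x - f K0 p\<bar> \<le> sum B (insert L R)" if "M \<in> R" "x \<in> M" for M x
      using bd[OF that] B0 KL(2) finR by simp
    ultimately show ?case
      using R KL(2) finR by (intro exI[of _ "insert L R"]) auto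
  qed
  \<comment> \<open>\<open>S\<close> is nonempty, so \<open>k = card S - 1\<close> is allowed, and
    the subfamily obtained for it is all of \<open>S\<close>.\<close>
  moreover have "Suc (card S - 1) = card S" using card_gt_0_iff[of S] S(1) p(1) by auto
  ultimately obtain R where R: "R \<subseteq> S" "card R = card S"
    "\<And>L x. L \<in> R \<Longrightarrow> x \<in> L \<Longrightarrow> \<bar>f L x - f K0 p\<bar> \<le> sum B R"
    by (metis order_refl)
  then have "R = S" using S(1) by (simp add: card_subset_eq)
  then show ?thesis using R(3) x by blast
qed

section \<open>Counting the elements along a segment\<close>

definition elements_meeting :: "point set set \<Rightarrow> point set \<Rightarrow> point set set" where
  "elements_meeting \<T> P = {K \<in> \<T>. K \<inter> P \<noteq> {}}"

text \<open>Projected to coordinate \<open>j\<close>, the segment becomes an interval of length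
  \<open>\<delta>\<close>, covered by the shadows of the elements, each of which fits into an
  interval of length \<open>2 * h\<close>.\<close>

lemma card_elements_meeting_segment_ge:
  fixes p :: point and h \<delta> :: real
  assumes fin: "finite \<T>" and bdd: "\<And>K. K \<in> \<T> \<Longrightarrow> bounded K \<and> diameter K \<le> h"
    and h: "0 < h" "0 \<le> \<delta>"
    and cov: "closed_segment p (p + axis j \<delta>) \<subseteq> \<Union>\<T>"
  shows "\<delta> \<le> 2 * h * card (elements_meeting \<T> (closed_segment p (p + axis j \<delta>)))"
proof -
  let ?P = "closed_segment p (p + axis j \<delta>)"
  let ?S = "elements_meeting \<T> ?P"
  define a where "a K = (SOME x. x \<in> K) $ j" for K :: "point set"
  have finS: "finite ?S" using fin by (simp add: elements_meeting_def)
  have "{p $ j..p $ j + \<delta>} \<subseteq> (\<Union>K\<in>?S. {a K - h..a K + h})"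
  proof
    fix r assume r: "r \<in> {p $ j..p $ j + \<delta>}"
    define q where "q = p + axis j (r - p $ j)"
    have "q \<in> ?P"
    proof (cases "\<delta> = 0")
      case True
      then show ?thesis using r by (simp add: q_def axis_def vec_eq_iff)
    next
      case False
      define u where "u = (r - p $ j) / \<delta>"
      have u: "0 \<le> u" "u \<le> 1" "u * \<delta> = r - p $ j"
        using False h(2) r by (simp_all add: u_def field_simps)
      have "q = (1 - u) *\<^sub>R p + u *\<^sub>R (p + axis j \<delta>)"
        using u(3) by (simp add: q_def vec_eq_iff axis_def algebra_simps)
      then show ?thesis using u by (auto simp: closed_segment_def)
    qed
    then obtain K where K: "K \<in> \<T>" "q \<in> K" using cov by blast
    then have KS: "K \<in> ?S" using \<open>q \<in> ?P\<close> by (auto simp: elements_meeting_def)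
    have "(SOME x. x \<in> K) \<in> K" using K(2) by (rule someI)
    then have "dist q (SOME x. x \<in> K) \<le> h"
      using diameter_bounded(1) bdd[OF K(1)] K(2) by (meson order_trans)
    then have "\<bar>q $ j - a K\<bar> \<le> h"
      using component_le_norm_cart[of "q - (SOME x. x \<in> K)" j] by (simp add: a_def dist_norm)
    moreover have "q $ j = r" by (simp add: q_def)
    ultimately have "r \<in> {a K - h..a K + h}" by (simp add: abs_le_iff)
    then show "r \<in> (\<Union>K\<in>?S. {a K - h..a K + h})" using KS by blast
  qed
  then have "measure lebesgue {p $ j..p $ j + \<delta>} \<le> measure lebesgue (\<Union>K\<in>?S. {a K - h..a K + h})"
    using finS by (intro measure_mono_fmeasurable) (auto intro!: fmeasurable.finite_UN)
  also have "\<dots> \<le> (\<Sum>K\<in>?S. measure lebesgue {a K - h..a K + h})"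
    using finS by (intro measure_UNION_le) auto
  also have "\<dots> = 2 * h * card ?S" using h by simp
  finally show ?thesis using h by simp
qed

text \<open>These elements lie in a rectangle with sides \<open>2 * h\<close> and
  \<open>2 * h + \<delta>\<close> around the segment and overlap only in null sets, so areas can be
  compared. With \<open>m\<close> of order h^2 the number is at most of order 1/h.\<close>

lemma card_elements_meeting_segment_le:
  fixes p :: point and h \<delta> m :: real
  assumes tri: "triangulation \<T>" and bdd: "\<And>K. K \<in> \<T> \<Longrightarrow> diameter K \<le> h"
    and h: "0 < h" "0 \<le> \<delta>" and m: "\<And>K. K \<in> \<T> \<Longrightarrow> m \<le> measure lebesgue K"
  shows "card (elements_meeting \<T> (closed_segment p (p + axis j \<delta>))) * m \<le> 4 * h * (\<delta> + h)"
proof -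
  let ?P = "closed_segment p (p + axis j \<delta>)"
  let ?S = "elements_meeting \<T> ?P"
  have finS: "finite ?S" and ST: "?S \<subseteq> \<T>"
    using tri by (auto simp: elements_meeting_def triangulation_def)
  have comp: "compact K" if "K \<in> ?S" for K
    using tri ST that unfolding triangulation_def by (metis compact_simplex subsetD)
  obtain i where i: "i \<noteq> j" "(UNIV::2 set) = {i, j}"
  proof (cases "j = 1")
    case True
    then show ?thesis using that[of 2] by (auto simp: UNIV_2)
  next
    case False
    then show ?thesis using that[of 1] exhaust_2[of j] by (auto simp: UNIV_2)
  qed
  define A where "A = p - vec h"
  define B where "B = p + vec h + axis j \<delta>"
  have sub: "K \<subseteq> cbox A B" if K: "K \<in> ?S" for K
  proof
    fix x assume x: "x \<in> K"
    obtain q where q: "q \<in> K" "q \<in> ?P" using K by (auto simp: elements_meeting_def)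
    then obtain u where u: "0 \<le> u" "u \<le> 1" "q = (1 - u) *\<^sub>R p + u *\<^sub>R (p + axis j \<delta>)"
      by (auto simp: closed_segment_def)
    have "dist x q \<le> h"
      using diameter_bounded(1)[OF compact_imp_bounded[OF comp[OF K]]] x q(1) bdd[of K] K ST
      by (meson order_trans subsetD)
    then have c: "\<bar>x $ k - q $ k\<bar> \<le> h" for k
      using component_le_norm_cart[of "x - q" k] by (simp add: dist_norm)
    have "q $ i = p $ i" using i(1) by (simp add: u(3) axis_def algebra_simps)
    moreover have "q $ j = p $ j + u * \<delta>" by (simp add: u(3) algebra_simps)
    moreover have "u * \<delta> \<le> 1 * \<delta>" using u h(2) by (intro mult_right_mono)
    moreover have "0 \<le> u * \<delta>" using u h(2) by simp
    ultimately have "A $ i \<le> x $ i \<and> x $ i \<le> B $ i" "A $ j \<le> x $ j \<and> x $ j \<le> B $ j"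
      using c[of i] c[of j] i(1) by (simp_all add: A_def B_def axis_def abs_le_iff)
    then have "\<forall>k\<in>{i, j}. A $ k \<le> x $ k \<and> x $ k \<le> B $ k" by blast
    then show "x \<in> cbox A B" unfolding mem_box_cart i(2)[symmetric] by blast
  qed
  have "card ?S * m \<le> (\<Sum>K\<in>?S. measure lebesgue K)"
    using m ST by (intro sum_bounded_below) auto
  also have "\<dots> = measure lebesgue (\<Union>?S)"
    using finS comp triangulation_negligible_overlap[OF tri] ST
    by (intro measure_negligible_finite_Union[symmetric])
      (auto intro: lmeasurable_compact simp: pairwise_def)
  also have "\<dots> \<le> measure lebesgue (cbox A B)"
    using sub finS comp by (intro measure_mono_fmeasurable) (auto intro!: lmeasurable_compact fmeasurableD)
  also have "\<dots> = (2 * h) * (2 * h + \<delta>)"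
  proof -
    have "cbox A B \<noteq> {}"
      using h by (auto simp: interval_ne_empty_cart A_def B_def axis_def)
    then have "measure lebesgue (cbox A B) = (\<Prod>k\<in>{i, j}. B $ k - A $ k)"
      by (simp add: content_cbox_cart i(2))
    also have "\<dots> = (2 * h) * (2 * h + \<delta>)"
      using i(1) by (simp add: A_def B_def axis_def)
    finally show ?thesis .
  qed
  also have "\<dots> \<le> 4 * h * (\<delta> + h)" using h by (simp add: algebra_simps)
  finally show ?thesis .
qed

section \<open>Transversal directions\<close>

text \<open>A set of diameter at most \<open>l\<close> lies in an interval \<open>Z j\<close> of
  length \<open>2 * l\<close>. Passing to intervals avoids measurability questions for
  \<open>A j\<close>; \<open>F\<close> may be any function, as suits a trace defined by choosing
  elements.\<close>

lemma set_integral_le_sum_short_sets: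
  fixes F :: "real \<Rightarrow> real"
  assumes "finite J" and q: "\<And>j. j \<in> J \<Longrightarrow> 0 \<le> q j" and "0 \<le> l"
    and short: "\<And>j s s'. j \<in> J \<Longrightarrow> s \<in> A j \<Longrightarrow> s' \<in> A j \<Longrightarrow> \<bar>s - s'\<bar> \<le> l"
    and F: "\<And>s. s \<in> I \<Longrightarrow> F s \<le> (\<Sum>j\<in>J. q j * indicator (A j) s)"
  shows "(LINT s:I|lebesgue. F s) \<le> 2 * l * sum q J"
proof -
  define Z where "Z j = (if A j = {} then {} else {(SOME s. s \<in> A j) - l..(SOME s. s \<in> A j) + l})" for j
  have AZ: "A j \<subseteq> Z j" if "j \<in> J" for j
  proof
    fix s assume s: "s \<in> A j"
    then have "(SOME s. s \<in> A j) \<in> A j" by (rule someI)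
    from short[OF that s this] show "s \<in> Z j" using s by (auto simp: Z_def)
  qed
  have Z: "Z j \<in> lmeasurable" "measure lebesgue (Z j) \<le> 2 * l" for j
    using \<open>0 \<le> l\<close> by (auto simp: Z_def)
  let ?g = "\<lambda>s. \<Sum>j\<in>J. q j * indicator (Z j) s"
  have gint: "integrable lebesgue ?g"
    using Z(1) by (intro Bochner_Integration.integrable_sum integrable_mult_right)
      (simp add: lmeasurable_iff_integrable)
  have g0: "0 \<le> ?g s" for s using q by (intro sum_nonneg mult_nonneg_nonneg) auto
  have le: "indicator I s *\<^sub>R F s \<le> ?g s" for s
  proof (cases "s \<in> I")
    case True
    have "F s \<le> (\<Sum>j\<in>J. q j * indicator (A j) s)" by (rule F[OF True])
    also have "\<dots> \<le> ?g s"
      using AZ q by (intro sum_mono mult_left_mono) (auto simp: indicator_def)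
    finally show ?thesis using True by simp
  qed (use g0 in simp)
  have "(LINT s:I|lebesgue. F s) \<le> integral\<^sup>L lebesgue ?g"
  proof (cases "integrable lebesgue (\<lambda>s. indicator I s *\<^sub>R F s)")
    case True
    then show ?thesis
      unfolding set_lebesgue_integral_def using gint le by (rule integral_mono)
  next
    \<comment> \<open>A non-integrable integrand has integral 0 by convention, and the right-hand
      side is nonnegative.\<close>
    case False
    then show ?thesis
      unfolding set_lebesgue_integral_def not_integrable_integral_eq[OF False]
      using g0 by (intro Bochner_Integration.integral_nonneg) auto
  qed
  also have "\<dots> = (\<Sum>j\<in>J. q j * measure lebesgue (Z j))"
    using Z(1) by (subst Bochner_Integration.integral_sum)
      (simp_all add: lmeasurable_iff_integrable)
  also have "\<dots> \<le> (\<Sum>j\<in>J. q j * (2 * l))"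
    using Z(2) q by (intro sum_mono mult_left_mono) auto
  also have "\<dots> = 2 * l * sum q J" by (simp add: sum_distrib_right[symmetric] mult.commute)
  finally show ?thesis .
qed

text \<open>On the compact rectangle of times and parameters the speed has a positive minimum
  \<open>m\<close>, and uniform continuity of the tangent yields subintervals of common length on
  which one tangent coordinate keeps size at least \<open>m / 4\<close>. Only that coordinate varies
  with \<open>t\<close> and \<open>k\<close>.\<close>

lemma smooth_moving_curve_transversal:
  assumes smc: "smooth_moving_curve tmax \<gamma>" and "0 \<le> tmax"
  obtains n :: nat and \<mu> M :: real where "0 < n" "0 < \<mu>" "0 < M"
    "\<And>t s. t \<in> {0..tmax} \<Longrightarrow> s \<in> {0..1} \<Longrightarrow>
       norm (vector_derivative (\<gamma> t) (at s within {0..1})) \<le> M"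
    "\<And>t k. t \<in> {0..tmax} \<Longrightarrow> k < n \<Longrightarrow> \<exists>i. \<forall>s\<in>{k/n..real (Suc k)/n}. \<forall>s'\<in>{k/n..real (Suc k)/n}.
       \<mu> * \<bar>s - s'\<bar> \<le> \<bar>\<gamma> t s $ i - \<gamma> t s' $ i\<bar>"
proof -
  define Q where "Q = {0..tmax} \<times> {0..1::real}"
  obtain \<gamma>' where cont: "continuous_on Q (\<lambda>(t, s). \<gamma>' t s)"
    and der: "\<And>t s. t \<in> {0..tmax} \<Longrightarrow> s \<in> {0..1} \<Longrightarrow>
        (\<gamma> t has_vector_derivative \<gamma>' t s) (at s within {0..1}) \<and> \<gamma>' t s \<noteq> 0"
    using smc unfolding smooth_moving_curve_def Q_def by blast
  have Q: "compact Q" "Q \<noteq> {}"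
    using \<open>0 \<le> tmax\<close> by (auto simp: Q_def intro!: compact_Times)
  have ncont: "continuous_on Q (\<lambda>z. norm (case z of (t, s) \<Rightarrow> \<gamma>' t s))"
    using cont by (rule continuous_on_norm)
  obtain z0 where z0: "z0 \<in> Q"
    "\<forall>z\<in>Q. norm (case z0 of (t, s) \<Rightarrow> \<gamma>' t s) \<le> norm (case z of (t, s) \<Rightarrow> \<gamma>' t s)"
    using continuous_attains_inf[OF Q ncont] by blast
  define m where "m = norm (case z0 of (t, s) \<Rightarrow> \<gamma>' t s)"
  have m0: "0 < m" using z0(1) der by (auto simp: m_def Q_def)
  have mle: "m \<le> norm (\<gamma>' t s)" if "t \<in> {0..tmax}" "s \<in> {0..1}" for t s
    using z0(2)[rule_format, of "(t, s)"] that by (simp add: m_def Q_def)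
  obtain z1 where z1: "z1 \<in> Q"
    "\<forall>z\<in>Q. norm (case z of (t, s) \<Rightarrow> \<gamma>' t s) \<le> norm (case z1 of (t, s) \<Rightarrow> \<gamma>' t s)"
    using continuous_attains_sup[OF Q ncont] by blast
  define M where "M = norm (case z1 of (t, s) \<Rightarrow> \<gamma>' t s)"
  have leM: "norm (\<gamma>' t s) \<le> M" if "t \<in> {0..tmax}" "s \<in> {0..1}" for t s
    using z1(2)[rule_format, of "(t, s)"] that by (simp add: M_def Q_def)
  have M0: "0 < M" using m0 mle[of 0 0] leM[of 0 0] \<open>0 \<le> tmax\<close> by simp
  have vd: "vector_derivative (\<gamma> t) (at s within {0..1}) = \<gamma>' t s"
    if "t \<in> {0..tmax}" "s \<in> {0..1}" for t s
    using vector_derivative_within_cbox[of 0 1 s "\<gamma> t" "\<gamma>' t s"] der[OF that] that by simp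
  have "uniformly_continuous_on Q (\<lambda>(t, s). \<gamma>' t s)"
    using cont Q(1) by (rule compact_uniformly_continuous)
  then obtain \<eta> where \<eta>: "0 < \<eta>"
    "\<And>y z. y \<in> Q \<Longrightarrow> z \<in> Q \<Longrightarrow> dist z y < \<eta> \<Longrightarrow>
        dist (case z of (t, s) \<Rightarrow> \<gamma>' t s) (case y of (t, s) \<Rightarrow> \<gamma>' t s) < m / 4"
    unfolding uniformly_continuous_on_def using m0 by (metis zero_less_divide_iff zero_less_numeral)
  obtain n :: nat where n: "1 / real n < \<eta>" "0 < n"
    using \<eta>(1) by (metis inverse_eq_divide ex_inverse_of_nat_less)
  have "\<exists>i. \<forall>s\<in>{k/n..real (Suc k)/n}. \<forall>s'\<in>{k/n..real (Suc k)/n}.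
       m / 4 * \<bar>s - s'\<bar> \<le> \<bar>\<gamma> t s $ i - \<gamma> t s' $ i\<bar>" if t: "t \<in> {0..tmax}" and k: "k < n" for t k
  proof -
    have "real (Suc k) / real n \<le> 1" using k n(2) by simp
    then have I: "{k/n..real (Suc k)/n} \<subseteq> {0..1::real}" by (auto intro: order_trans[rotated])
    define s0 where "s0 = real k / n"
    have s0I: "s0 \<in> {k/n..real (Suc k)/n}" using n(2) by (simp add: s0_def divide_right_mono)
    \<comment> \<open>One of the two components carries at least \<open>m / 2\<close>; a variation
      below \<open>m / 4\<close> leaves \<open>m / 4\<close>, which becomes
      \<open>\<mu>\<close>.\<close>
    have "m \<le> \<bar>\<gamma>' t s0 $ 1\<bar> + \<bar>\<gamma>' t s0 $ 2\<bar>"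
      using mle[OF t, of s0] norm_le_l1_cart[of "\<gamma>' t s0"] subsetD[OF I s0I] by (simp add: UNIV_2)
    then obtain i where i: "m / 2 \<le> \<bar>\<gamma>' t s0 $ i\<bar>"
      by (metis add_strict_mono field_sum_of_halves not_le)
    have big: "m / 4 \<le> \<bar>\<gamma>' t s $ i\<bar>" if s: "s \<in> {k/n..real (Suc k)/n}" for s
    proof -
      have "real (Suc k) / n - k / n = 1 / n" by (simp add: add_divide_distrib)
      then have "\<bar>s - s0\<bar> \<le> 1 / n" using s by (auto simp: s0_def)
      then have "dist (t, s) (t, s0) < \<eta>" using n(1) by (simp add: dist_prod_def dist_real_def)
      moreover have "(t, s) \<in> Q" "(t, s0) \<in> Q" using t subsetD[OF I s] subsetD[OF I s0I] by (simp_all add: Q_def)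
      ultimately have "dist (\<gamma>' t s) (\<gamma>' t s0) < m / 4" using \<eta>(2) by fastforce
      then have "\<bar>\<gamma>' t s $ i - \<gamma>' t s0 $ i\<bar> < m / 4"
        using component_le_norm_cart[of "\<gamma>' t s - \<gamma>' t s0" i] by (simp add: dist_norm)
      then show ?thesis using i by linarith
    qed
    have mvt: "m / 4 * \<bar>s - s'\<bar> \<le> \<bar>\<gamma> t s $ i - \<gamma> t s' $ i\<bar>"
      if s: "s \<in> {k/n..real (Suc k)/n}" "s' \<in> {k/n..real (Suc k)/n}" "s < s'" for s s'
    proof -
      have sub: "{s..s'} \<subseteq> {k/n..real (Suc k)/n}" using s by auto
      have "((\<lambda>r. \<gamma> t r $ i) has_derivative (\<lambda>h. h * (\<gamma>' t x $ i))) (at x within {s..s'})"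
        if "s \<le> x" "x \<le> s'" for x
      proof -
        have "x \<in> {0..1}" using that subset_trans[OF sub I] by (meson atLeastAtMost_iff subsetD)
        then have "(\<gamma> t has_vector_derivative \<gamma>' t x) (at x within {s..s'})"
          using der[OF t, of x] subset_trans[OF sub I] by (meson has_vector_derivative_within_subset order_trans)
        then have "((\<lambda>r. \<gamma> t r $ i) has_derivative (\<lambda>h. (h *\<^sub>R \<gamma>' t x) $ i)) (at x within {s..s'})"
          unfolding has_vector_derivative_def by (rule bounded_linear.has_derivative[OF bounded_linear_vec_nth])
        then show ?thesis by simp
      qed
      from mvt_simple[OF s(3) this] obtain x where x: "x \<in> {s<..<s'}"
        "\<gamma> t s' $ i - \<gamma> t s $ i = (s' - s) * (\<gamma>' t x $ i)" by blast
      have "m / 4 * \<bar>s - s'\<bar> \<le> \<bar>\<gamma>' t x $ i\<bar> * \<bar>s - s'\<bar>"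
        using x(1) sub by (intro mult_right_mono big) auto
      also have "\<dots> = \<bar>\<gamma> t s' $ i - \<gamma> t s $ i\<bar>"
        unfolding x(2) by (simp add: abs_mult abs_minus_commute mult.commute)
      finally show ?thesis by (simp add: abs_minus_commute)
    qed
    have "m / 4 * \<bar>s - s'\<bar> \<le> \<bar>\<gamma> t s $ i - \<gamma> t s' $ i\<bar>"
      if "s \<in> {k/n..real (Suc k)/n}" "s' \<in> {k/n..real (Suc k)/n}" for s s'
      using mvt[OF that] mvt[OF that(2,1)] by (cases s s' rule: linorder_cases) (auto simp: abs_minus_commute)
    then show ?thesis by blast
  qed
  then show thesis
    using that[of n "m / 4" M] n(2) m0 M0 vd leM by simp
qed

text \<open>The curves of all times together sweep out a compact subset of the open
  \<open>\<Omega>\<close>. The margin keeps segments of length \<open>\<delta>\<close> that start on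
  a curve inside the meshed domain.\<close>

lemma smooth_moving_curve_margin:
  assumes "smooth_moving_curve tmax \<gamma>" "open \<Omega>" "\<forall>t\<in>{0..tmax}. path_image (\<gamma> t) \<subseteq> \<Omega>"
  obtains \<delta> where "0 < \<delta>" "\<And>t s. t \<in> {0..tmax} \<Longrightarrow> s \<in> {0..1} \<Longrightarrow> cball (\<gamma> t s) \<delta> \<subseteq> \<Omega>"
proof -
  let ?A = "(\<lambda>(t, s). \<gamma> t s) ` ({0..tmax} \<times> {0..1})"
  have "compact ?A"
    using assms(1) unfolding smooth_moving_curve_def
    by (intro compact_continuous_image compact_Times) auto
  moreover have "?A \<subseteq> \<Omega>" using assms(3) by (auto simp: path_image_def)
  ultimately obtain \<delta> where "0 < \<delta>" "(\<Union>x\<in>?A. cball x \<delta>) \<subseteq> \<Omega>"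
    using compact_subset_open_imp_cball_epsilon_subset[OF _ assms(2)] by blast
  then show thesis using that[of \<delta>] by fastforce
qed

section \<open>The trace inequality\<close>

text \<open>Two opposite counts balance the powers of \<open>h\<close>. Averaging over
  \<open>N\<close> elements divides the factor 1/h^2 of the maximum bound by \<open>N\<close>, which
  is at least \<open>\<delta> / (2 * h)\<close>. Cauchy-Schwarz on the summed oscillations costs a
  factor \<open>N\<close>, which is at most of order 1/h.\<close>

lemma ife_space_pointwise_bound:
  fixes p :: point
  assumes adm: "admissible_mesh \<Omega> \<sigma> \<kappa> h0 \<T>" and fit: "mesh_fits_interface \<Gamma> \<T>"
    and v: "v \<in> ife_space \<beta>m \<beta>p \<Omega> \<Gamma> \<T>" and \<beta>: "0 < \<beta>m" "0 < \<beta>p"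
    and \<delta>: "0 < \<delta>" and cov: "closed_segment p (p + axis j \<delta>) \<subseteq> \<Union>\<T>"
    and K: "K \<in> \<T>" "p \<in> K"
  defines "R \<equiv> 1 + \<beta>m / \<beta>p + \<beta>p / \<beta>m" and "c \<equiv> (1 / (4 * \<sigma> * \<kappa>))\<^sup>2"
  shows "(v K p)\<^sup>2 \<le> (8 * (1 + R\<^sup>2 * h0\<^sup>2) / (c * \<delta>) + 8 * R\<^sup>2 * (\<delta> + h0) / c\<^sup>2) / mesh_size \<T> *
     (\<Sum>L\<in>elements_meeting \<T> (closed_segment p (p + axis j \<delta>)). (H1_norm L (v L))\<^sup>2)"
proof -
  define P where "P = closed_segment p (p + axis j \<delta>)"
  define S where "S = elements_meeting \<T> P"
  define h where "h = mesh_size \<T>"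
  define N where "N = real (card S)"
  define Q where "Q L = (H1_norm L (v L))\<^sup>2" for L
  have tri: "triangulation \<T>" and simp2: "\<And>L. L \<in> \<T> \<Longrightarrow> 2 simplex L" and hh0: "h \<le> h0"
    using adm by (auto simp: admissible_mesh_def h_def)
  have fin: "finite \<T>" using tri by (simp add: triangulation_def)
  have c0: "0 < c" and h: "0 < h"
    using admissible_mesh_element(1-3)[OF adm K(1)] by (simp_all add: c_def h_def)
  have R1: "1 \<le> R" using \<beta> by (simp add: R_def)
  have ST: "S \<subseteq> \<T>" and finS: "finite S" using fin by (auto simp: S_def elements_meeting_def)
  have pP: "p \<in> P" by (simp add: P_def)
  then have KS: "K \<in> S" using K by (auto simp: S_def elements_meeting_def)
  have comp: "compact L" "convex L" if "L \<in> \<T>" for L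
    using simp2[OF that] compact_simplex convex_simplex by auto
  have el: "diameter L \<le> h" "c * h\<^sup>2 \<le> measure lebesgue L" if "L \<in> \<T>" for L
    using admissible_mesh_element(4,5)[OF adm that] by (simp_all add: c_def h_def)
  have pa: "piecewise_affine_on R L (v L)" if L: "L \<in> \<T>" for L
    unfolding R_def
  proof (rule local_ife_space_piecewise_affine[OF _ \<beta>])
    show "v L \<in> local_ife_space \<beta>m \<beta>p \<Omega> \<Gamma> L" using v L by (simp add: ife_space_def)
    show "\<exists>D E. D \<noteq> E \<and> \<Gamma> \<inter> frontier L = {D, E}" if "interface_element \<Gamma> L"
      using fit L that unfolding mesh_fits_interface_def by blast
  qed
  note bd = piecewise_affine_element_bounds[OF pa comp el(1) R1 el(2) c0 h hh0]
  define B where "B L = R / sqrt c * H1_norm L (v L)" for L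
  have chain: "\<bar>v L x - v K p\<bar> \<le> sum B S" if "L \<in> S" "x \<in> L" for L x
  proof (rule connected_cover_oscillation[OF finS _ _ _ _ _ _ KS K(2) that])
    show "connected P" by (simp add: P_def)
    show "P \<subseteq> \<Union>S" using cov by (auto simp: S_def P_def elements_meeting_def)
    show "closed L" "L \<inter> P \<noteq> {}" if "L \<in> S" for L
      using that ST comp(1) compact_imp_closed by (auto simp: S_def elements_meeting_def)
    show "\<bar>v L x - v L y\<bar> \<le> B L" if "L \<in> S" "x \<in> L" "y \<in> L" for L x y
      using bd(1) that ST unfolding B_def by blast
    show "\<exists>z\<in>L \<inter> M. v L z = v M z" if "L \<in> S" "M \<in> S" "L \<inter> M \<noteq> {}" for L M
    proof -
      have LM: "L \<in> \<T>" "M \<in> \<T>" using that ST by auto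
      from triangulation_common_node[OF tri this that(3)] show ?thesis using v LM unfolding ife_space_def by blast
    qed
  qed
  have B2: "(sum B S)\<^sup>2 \<le> R\<^sup>2 / c * N * sum Q S"
  proof -
    have "(sum B S)\<^sup>2 \<le> (\<Sum>L\<in>S. (B L)\<^sup>2) * N"
      unfolding N_def by (rule sum_squared_le_sum_of_squares)
    also have "(\<Sum>L\<in>S. (B L)\<^sup>2) = R\<^sup>2 / c * sum Q S"
      using c0 by (simp add: B_def Q_def power_mult_distrib power_divide sum_distrib_left)
    finally show ?thesis by (simp add: mult_ac)
  qed
  have one: "(v K p)\<^sup>2 \<le> 4 * (1 + R\<^sup>2 * h0\<^sup>2) / (c * h\<^sup>2) * Q L + 2 * R\<^sup>2 / c * N * sum Q S"
    if L: "L \<in> S" for L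
  proof -
    obtain x where x: "x \<in> L" using L by (auto simp: S_def elements_meeting_def)
    have "(v K p)\<^sup>2 \<le> 2 * (v L x)\<^sup>2 + 2 * (v L x - v K p)\<^sup>2"
      using zero_le_power2[of "v K p - 2 * v L x"] by (simp add: power2_eq_square algebra_simps)
    moreover have "(v L x)\<^sup>2 \<le> 2 * (1 + R\<^sup>2 * h0\<^sup>2) / (c * h\<^sup>2) * Q L"
      unfolding Q_def using bd(2) x L ST by blast
    moreover have "(v L x - v K p)\<^sup>2 \<le> (sum B S)\<^sup>2"
      using power_mono[OF chain[OF L x], of 2] by simp
    ultimately have "(v K p)\<^sup>2 \<le> 2 * (2 * (1 + R\<^sup>2 * h0\<^sup>2) / (c * h\<^sup>2) * Q L) +
        2 * (R\<^sup>2 / c * N * sum Q S)" using B2 by linarith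
    then show ?thesis by (simp add: algebra_simps)
  qed
  have N0: "0 < N" using finS KS by (auto simp: N_def card_gt_0_iff)
  have Nge: "\<delta> \<le> 2 * h * N"
    using card_elements_meeting_segment_ge[OF fin _ h less_imp_le[OF \<delta>] cov]
      compact_imp_bounded[OF comp(1)] el(1) by (simp add: N_def S_def P_def)
  have "N * (c * h\<^sup>2) \<le> 4 * h * (\<delta> + h)"
    using card_elements_meeting_segment_le[OF tri el(1) h less_imp_le[OF \<delta>] el(2)]
    by (simp add: N_def S_def P_def)
  also have "\<dots> \<le> 4 * h * (\<delta> + h0)" using h hh0 by simp
  finally have "h * (N * (c * h)) \<le> h * (4 * (\<delta> + h0))" by (simp add: power2_eq_square mult_ac)
  then have "N * (c * h) \<le> 4 * (\<delta> + h0)" using h by simp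
  then have Nle: "N \<le> 4 * (\<delta> + h0) / (c * h)" using c0 h by (simp add: pos_le_divide_eq)
  have Q0: "0 \<le> sum Q S" by (simp add: Q_def sum_nonneg)
  \<comment> \<open>The first term of \<open>one\<close> involves only \<open>L\<close>, so
    summation produces \<open>sum Q S\<close> once; the second is the same for every
    \<open>L\<close> and gains the factor \<open>N\<close> that is finally cancelled.\<close>
  have "N * (v K p)\<^sup>2 = (\<Sum>L\<in>S. (v K p)\<^sup>2)" by (simp add: N_def)
  also have "\<dots> \<le> (\<Sum>L\<in>S. 4 * (1 + R\<^sup>2 * h0\<^sup>2) / (c * h\<^sup>2) * Q L + 2 * R\<^sup>2 / c * N * sum Q S)"
    using one by (rule sum_mono)
  also have "\<dots> = 4 * (1 + R\<^sup>2 * h0\<^sup>2) / (c * h\<^sup>2) * sum Q S + N * (2 * R\<^sup>2 / c * N * sum Q S)"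
    unfolding sum.distrib sum_distrib_left[symmetric] sum_constant N_def by (simp only: mult_ac)
  also have "\<dots> \<le> N * (8 * (1 + R\<^sup>2 * h0\<^sup>2) / (c * \<delta>) / h * sum Q S) +
      N * (2 * R\<^sup>2 / c * (4 * (\<delta> + h0) / (c * h)) * sum Q S)"
  proof (rule add_mono)
    \<comment> \<open>A factor \<open>\<delta>\<close> is inserted in order to be replaced by
      \<open>2 * h * N\<close>.\<close>
    have "4 * (1 + R\<^sup>2 * h0\<^sup>2) / (c * h\<^sup>2) = 4 * (1 + R\<^sup>2 * h0\<^sup>2) / (c * h\<^sup>2 * \<delta>) * \<delta>"
      using \<delta> by simp
    also have "\<dots> \<le> 4 * (1 + R\<^sup>2 * h0\<^sup>2) / (c * h\<^sup>2 * \<delta>) * (2 * h * N)"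
      using Nge c0 \<delta> by (intro mult_left_mono) auto
    also have "\<dots> = N * (8 * (1 + R\<^sup>2 * h0\<^sup>2) / (c * \<delta>) / h)"
      using h c0 \<delta> by (simp add: power2_eq_square field_simps)
    finally show "4 * (1 + R\<^sup>2 * h0\<^sup>2) / (c * h\<^sup>2) * sum Q S \<le>
        N * (8 * (1 + R\<^sup>2 * h0\<^sup>2) / (c * \<delta>) / h * sum Q S)"
      unfolding mult.assoc[symmetric, of N] by (rule mult_right_mono[OF _ Q0])
    show "N * (2 * R\<^sup>2 / c * N * sum Q S) \<le>
        N * (2 * R\<^sup>2 / c * (4 * (\<delta> + h0) / (c * h)) * sum Q S)"
      using Nle N0 Q0 c0 by (intro mult_left_mono mult_right_mono) auto
  qed
  also have "\<dots> = N * ((8 * (1 + R\<^sup>2 * h0\<^sup>2) / (c * \<delta>) + 8 * R\<^sup>2 * (\<delta> + h0) / c\<^sup>2) / h * sum Q S)"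
    using c0 h by (simp add: power2_eq_square add_divide_distrib distrib_left distrib_right)
  finally show ?thesis unfolding Q_def S_def P_def h_def using N0 by (rule mult_left_le_imp_le)
qed

theorem theorem4p5:
  fixes \<Omega> :: "point set" and \<gamma> :: "real \<Rightarrow> real \<Rightarrow> point"
    and tmax \<beta>m \<beta>p \<sigma> \<kappa> h0 :: real
  assumes "open \<Omega>" and "connected \<Omega>"
    and "0 \<le> tmax"
    and "smooth_moving_curve tmax \<gamma>"
    and "\<forall>t\<in>{0..tmax}. path_image (\<gamma> t) \<subseteq> \<Omega>"
    and "0 < \<beta>m" and "0 < \<beta>p"
  shows "\<exists>C>0. \<forall>t\<in>{0..tmax}. \<forall>\<T>.
           admissible_mesh \<Omega> \<sigma> \<kappa> h0 \<T> \<and> mesh_fits_interface (path_image (\<gamma> t)) \<T> \<longrightarrow>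
           (\<forall>v\<in>ife_space \<beta>m \<beta>p \<Omega> (path_image (\<gamma> t)) \<T>.
              L2_curve_norm (\<gamma> t) (broken_trace \<T> v) \<le> C * broken_H1_norm \<T> v)"
proof -
  obtain n :: nat and \<mu> M :: real where n: "0 < n" and \<mu>: "0 < \<mu>" and M: "0 < M"
    and leM: "\<And>t s. t \<in> {0..tmax} \<Longrightarrow> s \<in> {0..1} \<Longrightarrow>
       norm (vector_derivative (\<gamma> t) (at s within {0..1})) \<le> M"
    and transv: "\<And>t k. t \<in> {0..tmax} \<Longrightarrow> k < n \<Longrightarrow>
       \<exists>i. \<forall>s\<in>{k/n..real (Suc k)/n}. \<forall>s'\<in>{k/n..real (Suc k)/n}.
         \<mu> * \<bar>s - s'\<bar> \<le> \<bar>\<gamma> t s $ i - \<gamma> t s' $ i\<bar>"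
    using smooth_moving_curve_transversal[OF assms(4,3)] by blast
  obtain \<delta> where \<delta>: "0 < \<delta>"
    "\<And>t s. t \<in> {0..tmax} \<Longrightarrow> s \<in> {0..1} \<Longrightarrow> cball (\<gamma> t s) \<delta> \<subseteq> \<Omega>"
    using smooth_moving_curve_margin[OF assms(4,1,5)] by blast
  \<comment> \<open>All constants are fixed before the time, the mesh and the function are
    chosen.\<close>
  define R where "R = 1 + \<beta>m / \<beta>p + \<beta>p / \<beta>m"
  define c where "c = (1 / (4 * \<sigma> * \<kappa>))\<^sup>2"
  define C where "C = 8 * (1 + R\<^sup>2 * h0\<^sup>2) / (c * \<delta>) + 8 * R\<^sup>2 * (\<delta> + h0) / c\<^sup>2"
  define C' where "C' = 2 * n * M * C / \<mu>"
  \<comment> \<open>The absolute value and the added 1 keep the constant positive even when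
    \<open>\<sigma>\<close>, \<open>\<kappa>\<close>, \<open>h0\<close> admit no mesh and
    \<open>C\<close> may be zero or negative.\<close>
  have "L2_curve_norm (\<gamma> t) (broken_trace \<T> v) \<le> (sqrt \<bar>C'\<bar> + 1) * broken_H1_norm \<T> v"
    if t: "t \<in> {0..tmax}" and adm: "admissible_mesh \<Omega> \<sigma> \<kappa> h0 \<T>"
      and fit: "mesh_fits_interface (path_image (\<gamma> t)) \<T>"
      and v: "v \<in> ife_space \<beta>m \<beta>p \<Omega> (path_image (\<gamma> t)) \<T>" for t \<T> v
  proof -
    define h where "h = mesh_size \<T>"
    define Q where "Q K = (H1_norm K (v K))\<^sup>2" for K
    have tri: "triangulation \<T>" and cover: "\<Union>\<T> = closure \<Omega>" and "h \<le> h0"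
      using adm by (auto simp: admissible_mesh_def h_def)
    have fin: "finite \<T>" using tri by (simp add: triangulation_def)
    have \<gamma>\<Omega>: "\<gamma> t s \<in> \<Union>\<T>" if "s \<in> {0..1}" for s
      using \<delta>(1) \<delta>(2)[OF t that] cover closure_subset[of \<Omega>] by force
    obtain K0 where K0: "K0 \<in> \<T>" using \<gamma>\<Omega>[of 0] by auto
    have c0: "0 < c" and h0: "0 < h"
      using admissible_mesh_element(1-3)[OF adm K0] by (simp_all add: c_def h_def)
    have C0: "0 \<le> C" using \<open>h \<le> h0\<close> h0 c0 \<delta>(1) by (simp add: C_def)
    have "\<forall>k\<in>{..<n}. \<exists>i j. i \<noteq> j \<and>
        (\<forall>s\<in>{k/n..real (Suc k)/n}. \<forall>s'\<in>{k/n..real (Suc k)/n}.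
          \<mu> * \<bar>s - s'\<bar> \<le> \<bar>\<gamma> t s $ i - \<gamma> t s' $ i\<bar>)"
    proof
      fix k assume "k \<in> {..<n}"
      then obtain i where i: "\<forall>s\<in>{k/n..real (Suc k)/n}. \<forall>s'\<in>{k/n..real (Suc k)/n}.
          \<mu> * \<bar>s - s'\<bar> \<le> \<bar>\<gamma> t s $ i - \<gamma> t s' $ i\<bar>" using transv[OF t, of k] by auto
      \<comment> \<open>Arithmetic in the two-element index type is modulo 2, so
        \<open>i + 1\<close> is the other coordinate.\<close>
      have "i \<noteq> i + 1" by simp
      then show "\<exists>i j. i \<noteq> j \<and> (\<forall>s\<in>{k/n..real (Suc k)/n}. \<forall>s'\<in>{k/n..real (Suc k)/n}.
          \<mu> * \<bar>s - s'\<bar> \<le> \<bar>\<gamma> t s $ i - \<gamma> t s' $ i\<bar>)" using i by blast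
    qed
    then obtain i j :: "nat \<Rightarrow> 2" where ij: "\<And>k. k < n \<Longrightarrow> i k \<noteq> j k"
      and tr: "\<And>k s s'. k < n \<Longrightarrow> s \<in> {k/n..real (Suc k)/n} \<Longrightarrow> s' \<in> {k/n..real (Suc k)/n} \<Longrightarrow>
          \<mu> * \<bar>s - s'\<bar> \<le> \<bar>\<gamma> t s $ i k - \<gamma> t s' $ i k\<bar>"
      by (simp only: bchoice_iff lessThan_iff) blast
    \<comment> \<open>Segments in direction \<open>j k\<close> keep the coordinate
      \<open>i k\<close> of their starting point, and that coordinate separates the parameters of
      the \<open>k\<close>-th subinterval. Hence segments meeting the same element have parameters
      within \<open>h / \<mu>\<close>.\<close>
    define P where "P k s = closed_segment (\<gamma> t s) (\<gamma> t s + axis (j k) \<delta>)" for k s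
    define A where "A z = {s \<in> {fst z/n..real (Suc (fst z))/n}. snd z \<inter> P (fst z) s \<noteq> {}}"
      for z :: "nat \<times> point set"
    have proj: "x $ i k = \<gamma> t s $ i k" if "k < n" "x \<in> P k s" for k s x
      using that(2) ij[OF that(1)] by (auto simp: P_def closed_segment_def axis_def algebra_simps)
    have short: "\<bar>s - s'\<bar> \<le> h / \<mu>" if z: "z \<in> {..<n} \<times> \<T>" "s \<in> A z" "s' \<in> A z" for z s s'
    proof -
      obtain k K where k: "k < n" and K: "K \<in> \<T>" and zz: "z = (k, K)" using z(1) by auto
      obtain x x' where x: "x \<in> K" "x \<in> P k s" and x': "x' \<in> K" "x' \<in> P k s'"
        using z(2,3) by (auto simp: A_def zz)
      have "2 simplex K" using adm K by (simp add: admissible_mesh_def)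
      then have "dist x x' \<le> diameter K"
        using diameter_bounded(1)[OF compact_imp_bounded[OF compact_simplex]] x x' by blast
      then have "\<bar>x $ i k - x' $ i k\<bar> \<le> h"
        using component_le_norm_cart[of "x - x'" "i k"] admissible_mesh_element(4)[OF adm K]
        by (simp add: dist_norm h_def)
      then have "\<mu> * \<bar>s - s'\<bar> \<le> h"
        using tr[OF k, of s s'] z(2,3) proj[OF k x(2)] proj[OF k x'(2)] by (simp add: A_def zz)
      then show ?thesis using \<mu> by (simp add: pos_le_divide_eq mult.commute)
    qed
    \<comment> \<open>The weight carries \<open>1 / h\<close>, which will cancel against the length
      \<open>h / \<mu>\<close> of the parameter sets.\<close>
    define q where "q z = M * C / h * Q (snd z)" for z :: "nat \<times> point set"
    have q0: "0 \<le> q z" for z using M C0 h0 by (simp add: q_def Q_def)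
    define F where "F s = (broken_trace \<T> v (\<gamma> t s))\<^sup>2 *
        norm (vector_derivative (\<gamma> t) (at s within {0..1}))" for s
    have F: "F s \<le> (\<Sum>z\<in>{..<n} \<times> \<T>. q z * indicator (A z) s)" if s: "s \<in> {0..1}" for s
    proof -
      have "\<exists>k<n. s \<in> {k/n..real (Suc k)/n}"
      proof (cases "s = 1")
        \<comment> \<open>The endpoint belongs to the last subinterval; rounding down
          \<open>s * n\<close> would give the index \<open>n\<close>, one too many.\<close>
        case True
        then show ?thesis using n by (intro exI[of _ "n - 1"]) (auto simp: of_nat_diff)
      next
        case False
        define k where "k = nat \<lfloor>s * n\<rfloor>"
        have k: "real k \<le> s * n" "s * n < real (Suc k)"
          using s by (simp_all add: k_def) linarith
        have "s * n < n" using False s n by simp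
        then have "k < n" using k(1) by linarith
        then show ?thesis using k n by (intro exI[of _ k]) (auto simp: field_simps)
      qed
      then obtain k where k: "k < n" "s \<in> {k/n..real (Suc k)/n}" by blast
      \<comment> \<open>This is the element selected by \<open>broken_trace\<close>. The pointwise
        bound holds for every element containing the point, so the selection does not
        matter.\<close>
      define K where "K = (SOME K. K \<in> \<T> \<and> \<gamma> t s \<in> K)"
      have "\<exists>K. K \<in> \<T> \<and> \<gamma> t s \<in> K" using \<gamma>\<Omega>[OF s] by blast
      then have K: "K \<in> \<T>" "\<gamma> t s \<in> K" unfolding K_def by (metis (mono_tags, lifting) someI_ex)+
      have "\<gamma> t s + axis (j k) \<delta> \<in> cball (\<gamma> t s) \<delta>" using \<delta>(1) by (simp add: dist_norm norm_eq_sqrt_inner inner_axis_axis)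
      then have "P k s \<subseteq> cball (\<gamma> t s) \<delta>"
        unfolding P_def using \<delta>(1) by (intro closed_segment_subset) auto
      then have seg: "P k s \<subseteq> \<Union>\<T>" using \<delta>(2)[OF t s] cover closure_subset[of \<Omega>] by blast
      have "(v K (\<gamma> t s))\<^sup>2 \<le> C / h * sum Q (elements_meeting \<T> (P k s))"
        using ife_space_pointwise_bound[OF adm fit v assms(6,7) \<delta>(1) seg[unfolded P_def] K]
        by (simp add: C_def R_def c_def h_def Q_def P_def)
      then have "F s \<le> C / h * sum Q (elements_meeting \<T> (P k s)) * M"
        unfolding F_def broken_trace_def K_def[symmetric]
        using leM[OF t s] C0 h0 by (intro mult_mono) (auto simp: Q_def sum_nonneg)
      also have "\<dots> = (\<Sum>K\<in>elements_meeting \<T> (P k s). q (k, K))"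
        by (simp add: q_def sum_distrib_left mult_ac)
      also have "\<dots> = (\<Sum>z\<in>Pair k ` elements_meeting \<T> (P k s). q z * indicator (A z) s)"
        using k by (subst sum.reindex) (auto simp: inj_on_def A_def elements_meeting_def intro!: sum.cong)
      also have "\<dots> \<le> (\<Sum>z\<in>{..<n} \<times> \<T>. q z * indicator (A z) s)"
        using k(1) fin q0 by (intro sum_mono2) (auto simp: elements_meeting_def)
      finally show ?thesis .
    qed
    have "(LINT s:{0..1}|lebesgue. F s) \<le> 2 * (h / \<mu>) * sum q ({..<n} \<times> \<T>)"
      using h0 \<mu> fin by (intro set_integral_le_sum_short_sets[OF _ q0 _ short F]) auto
    also have "sum q ({..<n} \<times> \<T>) = n * (M * C / h * sum Q \<T>)"
      by (simp add: q_def sum.cartesian_product' sum_distrib_left)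
    also have "2 * (h / \<mu>) * (n * (M * C / h * sum Q \<T>)) = C' * sum Q \<T>"
      using h0 by (simp add: C'_def)
    finally have "L2_curve_norm (\<gamma> t) (broken_trace \<T> v) \<le> sqrt (C' * sum Q \<T>)"
      by (simp add: L2_curve_norm_def F_def)
    also have "\<dots> \<le> sqrt (\<bar>C'\<bar> * sum Q \<T>)"
      by (intro real_sqrt_le_mono mult_right_mono) (auto simp: Q_def sum_nonneg)
    also have "\<dots> = sqrt \<bar>C'\<bar> * broken_H1_norm \<T> v"
      by (simp add: real_sqrt_mult broken_H1_norm_def Q_def)
    also have "\<dots> \<le> (sqrt \<bar>C'\<bar> + 1) * broken_H1_norm \<T> v"
      by (intro mult_right_mono) (auto simp: broken_H1_norm_def sum_nonneg)
    finally show ?thesis .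
  qed
  then show ?thesis by (intro exI[of _ "sqrt \<bar>C'\<bar> + 1"]) (auto intro: add_nonneg_pos)
qed

end
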